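(* Let $n\ge2$, $j\ge1$, $j\not\equiv0\pmod n$. Let $\gamma_0\in\mathcal{M}_n(S^1)$ with central affine curvatures $u_1^0,\ldots,u_{n-1}^0$ and central affine moving frame $g_0$. Suppose $u=\sum_{i=1}^{n-1}u_ie_{in}$ is the solution, periodic in $x$, of the $j$-th $A^{(1)}_{n-1}$-KdV flow $u_t=[\partial_x+b+u,Z_{j,0}(u)]$ with initial data $u(x,0)=\sum_{i=1}^{n-1}u_i^0(x)e_{in}$. Let $g:\mathbb{R}^2\to SL(n,\mathbb{R})$ be the solution of $g^{-1}g_x=b+u$, $g^{-1}g_t=Z_{j,0}(u)$ with $g(0,0)=g_0(0)$. Then $\gamma=ge_1$ is a solution of the $j$-th central affine curve flow $\gamma_t=gZ_{j,0}(u)e_1$ with $\gamma(x,0)=\gamma_0(x)$. Moreover, $\gamma(x,t)$ is periodic in $x$ and $u_1(\cdot,t),\ldots,u_{n-1}(\cdot,t)$ are the central affine curvatures of $\gamma(\cdot,t)$.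
   Context: Let $I=\mathbb{R}$ or $S^1=\mathbb{R}/2\pi\mathbb{Z}$ (functions on $S^1$ are identified with $2\pi$-periodic functions). $\mathcal{M}_n(I)$ is the set of smooth $\gamma:I\to\mathbb{R}^n\setminus\{0\}$ with $\det(\gamma,\gamma_x,\ldots,\gamma_x^{(n-1)})=1$. For such $\gamma$ the central affine moving frame $g=(\gamma,\ldots,\gamma_x^{(n-1)})$ satisfies $g_x=g(b+u)$ with $b=\sum_{i=1}^{n-1}e_{i+1,i}$ and $u=\sum_{i=1}^{n-1}u_ie_{in}$, where $\gamma_x^{(n)}=u_1\gamma+\cdots+u_{n-1}\gamma_x^{(n-2)}$; $u_1,\ldots,u_{n-1}$ are the central affine curvatures. $V_n=\bigoplus_{i=1}^{n-1}\mathbb{R}e_{in}$, $e_1=(1,0,\ldots,0)^t$. A solution of the $j$-th central affine curve flow is a smooth $\gamma(x,t)$ with $\gamma(\cdot,t)\in\mathcal{M}_n(I)$ and $\gamma_t=gZ_{j,0}(u)e_1$, with $g(\cdot,t)$, $u(\cdot,t)$ the moving frame and curvature of $\gamma(\cdot,t)$. Let $J=e_{1n}\lambda+b$. For smooth $V_n$-valued $u$, let $Y(u,\lambda)=e_{1n}\lambda+\sum_{i\le 0}Y_{1,i}(u)\lambda^i$ be the unique formal series with smooth $sl(n)$-valued coefficients satisfying $Y_x+[J+u,Y]=0$ and $Y^n=\lambda I_n$; its coefficients are differential polynomials in $u$ (in the variable $x$). Write $Y(u,\lambda)^j=\sum_i Y_{j,i}(u)\lambda^i$. There is a unique strictly upper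 triangular $\zeta_j(u)$ (entries differential polynomials in $u$) with $[\partial_x+b+u,\,Y_{j,0}(u)-\zeta_j(u)]\in V_n$, where $[\partial_x+A,B]=B_x+[A,B]$. Set $Z_{j,0}(u)=Y_{j,0}(u)-\zeta_j(u)$. *)

theory Defs
  imports
    "HOL-Analysis.Derivative"
    "HOL-Computational_Algebra.Formal_Laurent_Series"
    "Jordan_Normal_Form.Determinant"
begin

text \<open>
  Vectors and matrices are those of \<^theory>\<open>Jordan_Normal_Form.Matrix\<close>, so indices start at \<open>0\<close>:
  the matrix unit $e_{rc}$ has its entry at position \<open>(r - 1, c - 1)\<close>.  The curvatures
  \<open>u i\<close>, however, keep the indices \<open>i = 1, \<dots>, n - 1\<close>.
\<close>

section \<open>Smooth maps\<close>

fun Ck :: "nat \<Rightarrow> ('a::real_normed_vector \<Rightarrow> 'b::real_normed_vector) \<Rightarrow> bool" where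
  "Ck 0 f \<longleftrightarrow> continuous_on UNIV f"
| "Ck (Suc k) f \<longleftrightarrow>
     (\<forall>x. f differentiable (at x)) \<and> (\<forall>v. Ck k (\<lambda>x. frechet_derivative f (at x) v))"

definition smooth :: "('a::real_normed_vector \<Rightarrow> 'b::real_normed_vector) \<Rightarrow> bool" where
  "smooth f \<longleftrightarrow> (\<forall>k. Ck k f)"

definition smooth_vec :: "nat \<Rightarrow> ('a::real_normed_vector \<Rightarrow> real Matrix.vec) \<Rightarrow> bool" where
  "smooth_vec n f \<longleftrightarrow>
     (\<forall>x. f x \<in> carrier_vec n) \<and> (\<forall>r<n. smooth (\<lambda>x. vec_index (f x) r))"

definition smooth_mat :: "nat \<Rightarrow> ('a::real_normed_vector \<Rightarrow> real mat) \<Rightarrow> bool" where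
  "smooth_mat n F \<longleftrightarrow>
     (\<forall>x. F x \<in> carrier_mat n n) \<and> (\<forall>r<n. \<forall>c<n. smooth (\<lambda>x. F x $$ (r, c)))"

definition vec_deriv :: "nat \<Rightarrow> (real \<Rightarrow> real Matrix.vec) \<Rightarrow> real \<Rightarrow> real Matrix.vec" where
  "vec_deriv n f x = Matrix.vec n (\<lambda>r. deriv (\<lambda>y. vec_index (f y) r) x)"

definition mat_deriv :: "nat \<Rightarrow> (real \<Rightarrow> real mat) \<Rightarrow> real \<Rightarrow> real mat" where
  "mat_deriv n F x = Matrix.mat n n (\<lambda>(r, c). deriv (\<lambda>y. F y $$ (r, c)) x)"

section \<open>Central affine curves\<close>

definition frame :: "nat \<Rightarrow> (real \<Rightarrow> real Matrix.vec) \<Rightarrow> real \<Rightarrow> real mat" where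
  "frame n \<gamma> x = mat_of_cols n (map (\<lambda>k. (vec_deriv n ^^ k) \<gamma> x) [0..<n])"

definition curves_R :: "nat \<Rightarrow> (real \<Rightarrow> real Matrix.vec) set" where
  "curves_R n =
     {\<gamma>. smooth_vec n \<gamma> \<and> (\<forall>x. \<gamma> x \<noteq> 0\<^sub>v n) \<and> (\<forall>x. det (frame n \<gamma> x) = 1)}"

definition curves_S1 :: "nat \<Rightarrow> (real \<Rightarrow> real Matrix.vec) set" where
  "curves_S1 n = {\<gamma> \<in> curves_R n. \<forall>x. \<gamma> (x + 2 * pi) = \<gamma> x}"

definition central_affine_curvatures ::
    "nat \<Rightarrow> (real \<Rightarrow> real Matrix.vec) \<Rightarrow> (nat \<Rightarrow> real \<Rightarrow> real) \<Rightarrow> bool" where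
  "central_affine_curvatures n \<gamma> u \<longleftrightarrow>
     (\<forall>x. (vec_deriv n ^^ n) \<gamma> x =
        finsum_vec TYPE(real) n (\<lambda>i. u i x \<cdot>\<^sub>v (vec_deriv n ^^ (i - 1)) \<gamma> x) {1..n - 1})"

definition SL :: "nat \<Rightarrow> real mat set" where
  "SL n = {A \<in> carrier_mat n n. det A = 1}"

definition b_mat :: "nat \<Rightarrow> real mat" where
  "b_mat n = Matrix.mat n n (\<lambda>(r, c). if r = c + 1 then 1 else 0)"

definition e1n_mat :: "nat \<Rightarrow> real mat" where
  "e1n_mat n = Matrix.mat n n (\<lambda>(r, c). if r = 0 \<and> c = n - 1 then 1 else 0)"

text \<open>The matrix $\sum_{i=1}^{n-1} w_i e_{in}$ and the space $V_n$ of all such matrices.\<close>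

definition u_mat :: "nat \<Rightarrow> (nat \<Rightarrow> real) \<Rightarrow> real mat" where
  "u_mat n w = Matrix.mat n n (\<lambda>(r, c). if r < n - 1 \<and> c = n - 1 then w (r + 1) else 0)"

definition V_space :: "nat \<Rightarrow> real mat set" where
  "V_space n = range (u_mat n)"

section \<open>The differential polynomials \<open>Y\<close>, \<open>\<zeta>\<close> and \<open>Z\<close>\<close>

text \<open>
  Formal series in \<open>\<lambda>\<close> with finitely many positive powers are formal Laurent series in
  the variable \<open>\<lambda>\<inverse>\<close>.  Hence \<open>\<lambda>\<close> is \<^const>\<open>fls_X_inv\<close>, and the coefficient
  of \<open>\<lambda>\<^sup>i\<close> is the one with index \<open>- i\<close>.
\<close>

definition lam_coeff :: "int \<Rightarrow> real fls mat \<Rightarrow> real mat" where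
  "lam_coeff i A = map_mat (\<lambda>f. fls_nth f (- i)) A"

definition J_mat :: "nat \<Rightarrow> real fls mat" where
  "J_mat n = fls_X_inv \<cdot>\<^sub>m map_mat fls_const (e1n_mat n) + map_mat fls_const (b_mat n)"

definition commutator :: "'a::ring mat \<Rightarrow> 'a mat \<Rightarrow> 'a mat" where
  "commutator A B = A * B - B * A"

text \<open>$[\partial_x + A, B] = B_x + [A, B]$\<close>

definition conn_bracket ::
    "nat \<Rightarrow> (real \<Rightarrow> real mat) \<Rightarrow> (real \<Rightarrow> real mat) \<Rightarrow> real \<Rightarrow> real mat" where
  "conn_bracket n A B x = mat_deriv n B x + commutator (A x) (B x)"

text \<open>In the following definitions \<open>u\<close> is a smooth $V_n$-valued function of \<open>x\<close>.\<close>

definition is_Y :: "nat \<Rightarrow> (real \<Rightarrow> real mat) \<Rightarrow> (real \<Rightarrow> real fls mat) \<Rightarrow> bool" where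
  "is_Y n u Y \<longleftrightarrow>
     (\<forall>x. Y x \<in> carrier_mat n n) \<and>
     (\<forall>i. smooth_mat n (\<lambda>x. lam_coeff i (Y x))) \<and>
     (\<forall>i x. (\<Sum>r<n. lam_coeff i (Y x) $$ (r, r)) = 0) \<and>
     (\<forall>i>1. \<forall>x. lam_coeff i (Y x) = 0\<^sub>m n n) \<and>
     (\<forall>x. lam_coeff 1 (Y x) = e1n_mat n) \<and>
     (\<forall>i x. mat_deriv n (\<lambda>y. lam_coeff i (Y y)) x
        + lam_coeff i (commutator (J_mat n + map_mat fls_const (u x)) (Y x)) = 0\<^sub>m n n) \<and>
     (\<forall>x. Y x ^\<^sub>m n = fls_X_inv \<cdot>\<^sub>m 1\<^sub>m n)"

definition Y_series :: "nat \<Rightarrow> (real \<Rightarrow> real mat) \<Rightarrow> real \<Rightarrow> real fls mat" where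
  "Y_series n u = (THE Y. is_Y n u Y)"

definition Y_coeff :: "nat \<Rightarrow> nat \<Rightarrow> int \<Rightarrow> (real \<Rightarrow> real mat) \<Rightarrow> real \<Rightarrow> real mat" where
  "Y_coeff n j i u x = lam_coeff i (Y_series n u x ^\<^sub>m j)"

definition is_zeta ::
    "nat \<Rightarrow> nat \<Rightarrow> (real \<Rightarrow> real mat) \<Rightarrow> (real \<Rightarrow> real mat) \<Rightarrow> bool" where
  "is_zeta n j u \<zeta> \<longleftrightarrow>
     smooth_mat n \<zeta> \<and>
     (\<forall>x. \<forall>r<n. \<forall>c\<le>r. \<zeta> x $$ (r, c) = 0) \<and>
     (\<forall>x. conn_bracket n (\<lambda>y. b_mat n + u y) (\<lambda>y. Y_coeff n j 0 u y - \<zeta> y) x \<in> V_space n)"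

definition zeta :: "nat \<Rightarrow> nat \<Rightarrow> (real \<Rightarrow> real mat) \<Rightarrow> real \<Rightarrow> real mat" where
  "zeta n j u = (THE \<zeta>. is_zeta n j u \<zeta>)"

definition Z0 :: "nat \<Rightarrow> nat \<Rightarrow> (real \<Rightarrow> real mat) \<Rightarrow> real \<Rightarrow> real mat" where
  "Z0 n j u x = Y_coeff n j 0 u x - zeta n j u x"

section \<open>The flows\<close>

text \<open>Functions of space and time take the arguments in the order \<open>x\<close>, \<open>t\<close>.\<close>

definition kdv_solution :: "nat \<Rightarrow> nat \<Rightarrow> (nat \<Rightarrow> real \<Rightarrow> real \<Rightarrow> real) \<Rightarrow> bool" where
  "kdv_solution n j u \<longleftrightarrow>
     (\<forall>i\<in>{1..n - 1}. smooth (\<lambda>(x, t). u i x t)) \<and>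
     (\<forall>x t. mat_deriv n (\<lambda>s. u_mat n (\<lambda>i. u i x s)) t =
        conn_bracket n (\<lambda>y. b_mat n + u_mat n (\<lambda>i. u i y t))
          (Z0 n j (\<lambda>y. u_mat n (\<lambda>i. u i y t))) x)"

definition curve_flow_solution :: "nat \<Rightarrow> nat \<Rightarrow> (real \<Rightarrow> real \<Rightarrow> real Matrix.vec) \<Rightarrow> bool" where
  "curve_flow_solution n j \<gamma> \<longleftrightarrow>
     smooth_vec n (\<lambda>(x, t). \<gamma> x t) \<and>
     (\<forall>t. (\<lambda>x. \<gamma> x t) \<in> curves_R n) \<and>
     (\<exists>u. (\<forall>t. central_affine_curvatures n (\<lambda>x. \<gamma> x t) (\<lambda>i x. u i x t)) \<and>
          (\<forall>x t. vec_deriv n (\<gamma> x) t =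
             (frame n (\<lambda>y. \<gamma> y t) x * Z0 n j (\<lambda>y. u_mat n (\<lambda>i. u i y t)) x)
               *\<^sub>v unit_vec n 0))"

end

theory Submission
  imports Defs
begin

text \<open>
  The pair \<open>(b + u, Z)\<close> makes the columns of \<open>g\<close> the successive \<open>x\<close>-derivatives of \<open>\<gamma> = g e\<^sub>1\<close>, so \<open>g\<close>
  is the moving frame of \<open>\<gamma>\<close>.  Uniqueness for the linear equation \<open>g\<^sub>x = g (b + u)\<close> at \<open>t = 0\<close>
  identifies \<open>g(\<cdot>, 0)\<close> with the frame of \<open>\<gamma>\<^sub>0\<close>, and uniqueness for \<open>g\<^sub>t = g Z\<close> propagates periodicity
  in \<open>x\<close> from \<open>t = 0\<close> to all \<open>t\<close>, provided that \<open>Z\<close> is periodic when \<open>u\<close> is.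

  The last point needs that \<open>Y\<close> and \<open>\<zeta>\<close> exist and are unique.  In the principal grading
  \<open>J\<close> has degree \<open>1\<close> and \<open>ad J\<close> has kernel spanned by the powers of \<open>J\<close>.  Hence the top component of a
  solution of \<open>Y\<^sub>x + [J + u, Y] = 0\<close>, or of a difference of two, is a multiple of a power of \<open>J\<close>, and
  \<open>Y\<^sup>n = \<lambda>\<close> determines the multiple.  For existence one conjugates \<open>\<partial>\<^sub>x + J + u\<close> to \<open>\<partial>\<^sub>x + J + f\<close> with \<open>f\<close> a
  series in \<open>J\<inverse>\<close> and takes \<open>Y = T J T\<inverse>\<close>.
\<close>

section \<open>Smooth functions\<close>

text \<open>\<open>Y_series\<close> and \<open>zeta\<close> are definite descriptions, so without a
  unique witness nothing is known about \<open>Z0\<close>, not even its size. This is why existence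
  has to be shown for objects of which the theorem uses only size and periodicity. Periodicity then
  comes from uniqueness rather than from the coefficients being differential polynomials: the
  translate of a solution by a period of \<open>u\<close> solves the same problem.

  Powers of \<lambda> are too coarse a grading for the recursions. The leading term e_{1n} of J is
  nilpotent, so the equation in a given power of \<lambda> determines the next coefficient only
  partly. The principal grading gives e_{rc} \<lambda>^i the degree r - c + n i. There J is
  homogeneous and invertible, \<open>u\<close> has only degrees at most 0, and J therefore governs
  the top degree of every equation. All series are built or compared one degree at a time,
  downwards.\<close>

lemma frechet_derivative_eqI:
  "(f has_derivative f') (at x) \<Longrightarrow> frechet_derivative f (at x) = f'"
  by (rule frechet_derivative_at[symmetric])

lemma has_frechet_derivative:
  "f differentiable (at x) \<Longrightarrow> (f has_derivative frechet_derivative f (at x)) (at x)"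
  by (simp add: frechet_derivative_works)

text \<open>The product rule leaves one factor undifferentiated, so the induction for products needs
  a factor of order \<open>Suc k\<close> at order \<open>k\<close> as well.\<close>

lemma Ck_SucD: "Ck (Suc k) f \<Longrightarrow> Ck k f"
proof (induction k arbitrary: f)
  case 0
  then show ?case
    by (auto intro!: differentiable_imp_continuous_on simp: differentiable_on_def)
qed simp

lemma Ck_const: "Ck k (\<lambda>x. c)"
  by (induction k arbitrary: c) (auto simp: frechet_derivative_eqI[OF has_derivative_const])

lemma Ck_add: "Ck k f \<Longrightarrow> Ck k g \<Longrightarrow> Ck k (\<lambda>x. f x + g x)"
proof (induction k arbitrary: f g)
  case (Suc k)
  have "frechet_derivative (\<lambda>x. f x + g x) (at x) =
      (\<lambda>v. frechet_derivative f (at x) v + frechet_derivative g (at x) v)" for x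
    using Suc.prems by (intro frechet_derivative_eqI has_derivative_add has_frechet_derivative) auto
  then show ?case
    using Suc by auto
qed (auto intro: continuous_intros)

lemma Ck_mult:
  fixes f g :: "'a::real_normed_vector \<Rightarrow> real"
  shows "Ck k f \<Longrightarrow> Ck k g \<Longrightarrow> Ck k (\<lambda>x. f x * g x)"
proof (induction k arbitrary: f g)
  case (Suc k)
  have "frechet_derivative (\<lambda>x. f x * g x) (at x) =
      (\<lambda>v. f x * frechet_derivative g (at x) v + frechet_derivative f (at x) v * g x)" for x
    using Suc.prems by (intro frechet_derivative_eqI has_derivative_mult has_frechet_derivative) auto
  then show ?case
    using Suc Ck_SucD[OF Suc.prems(1)] Ck_SucD[OF Suc.prems(2)] by (auto intro!: Ck_add)
qed (auto intro: continuous_intros)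

text \<open>One statement covers both uses: \<open>l\<close> the identity gives translations,
  \<open>l\<close> the embedding of an axis gives restrictions of a function of
  \<open>(x, t)\<close> to a line.\<close>

lemma Ck_compose_affine:
  assumes l: "bounded_linear l"
  shows "Ck k f \<Longrightarrow> Ck k (\<lambda>x. f (c + l x))"
proof (induction k arbitrary: f)
  case 0
  then show ?case
    using linear_continuous_on[OF l]
    by (auto intro!: continuous_on_compose2[of UNIV f] continuous_intros)
next
  case (Suc k)
  have d: "((\<lambda>x. f (c + l x)) has_derivative (\<lambda>v. frechet_derivative f (at (c + l x)) (l v))) (at x)" for x
  proof -
    have "((\<lambda>x. c + l x) has_derivative l) (at x)"
      using has_derivative_add[OF has_derivative_const bounded_linear_imp_has_derivative[OF l], of c]
      by simp
    from has_derivative_compose[OF this has_frechet_derivative] show ?thesis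
      using Suc.prems by auto
  qed
  then show ?case
    using Suc by (auto simp: frechet_derivative_eqI[OF d] differentiable_def intro: Suc.IH)
qed

lemma smooth_const [simp, intro]: "smooth (\<lambda>x. c)"
  by (simp add: smooth_def Ck_const)

lemma smooth_add [intro]: "smooth f \<Longrightarrow> smooth g \<Longrightarrow> smooth (\<lambda>x. f x + g x)"
  by (simp add: smooth_def Ck_add)

lemma smooth_mult [intro]:
  fixes f g :: "'a::real_normed_vector \<Rightarrow> real"
  shows "smooth f \<Longrightarrow> smooth g \<Longrightarrow> smooth (\<lambda>x. f x * g x)"
  by (simp add: smooth_def Ck_mult)

lemma smooth_uminus [intro]:
  fixes f :: "'a::real_normed_vector \<Rightarrow> real"
  shows "smooth f \<Longrightarrow> smooth (\<lambda>x. - f x)"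
  using smooth_mult[OF smooth_const[of "-1"]] by force

lemma smooth_diff [intro]:
  fixes f g :: "'a::real_normed_vector \<Rightarrow> real"
  shows "smooth f \<Longrightarrow> smooth g \<Longrightarrow> smooth (\<lambda>x. f x - g x)"
  using smooth_add[OF _ smooth_uminus, of f g] by simp

lemma smooth_sum [intro]:
  "(\<And>i. i \<in> I \<Longrightarrow> smooth (f i)) \<Longrightarrow> smooth (\<lambda>x. \<Sum>i\<in>I. f i x)"
  by (induction I rule: infinite_finite_induct) auto

lemma smooth_if:
  "(b \<Longrightarrow> smooth f) \<Longrightarrow> (\<not> b \<Longrightarrow> smooth g) \<Longrightarrow> smooth (\<lambda>x. if b then f x else g x)"
  by (cases b) auto

lemma smooth_compose_affine:
  "bounded_linear l \<Longrightarrow> smooth f \<Longrightarrow> smooth (\<lambda>x. f (c + l x))"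
  by (simp add: smooth_def Ck_compose_affine)

lemma smooth_shift: "smooth f \<Longrightarrow> smooth (\<lambda>x. f (x + c))"
  using smooth_compose_affine[OF bounded_linear_ident, of f c] by (simp add: add.commute)

lemma smooth_slice:
  assumes "smooth (\<lambda>(x, t). f x t)"
  shows "smooth (\<lambda>x. f x t)"
proof -
  have "bounded_linear (\<lambda>x. (x, 0))"
    by (intro bounded_linear_Pair bounded_linear_ident bounded_linear_zero)
  from smooth_compose_affine[OF this assms, of "(0, t)"] show ?thesis
    by simp
qed

lemma smooth_slice_snd:
  assumes "smooth (\<lambda>(x, t). f x t)"
  shows "smooth (f x)"
proof -
  have "bounded_linear (\<lambda>t. (0, t))"
    by (intro bounded_linear_Pair bounded_linear_ident bounded_linear_zero)
  from smooth_compose_affine[OF this assms, of "(x, 0)"] show ?thesis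
    by simp
qed

lemma smooth_differentiable: "smooth f \<Longrightarrow> f differentiable (at x)"
  unfolding smooth_def by (metis Ck.simps(2))

lemma smooth_DERIV:
  fixes f :: "real \<Rightarrow> real"
  shows "smooth f \<Longrightarrow> (f has_real_derivative deriv f x) (at x)"
  using smooth_differentiable[of f x]
  by (simp add: DERIV_deriv_iff_real_differentiable)

text \<open>\<open>smooth\<close> is phrased with Frechet derivatives in a fixed direction; in one
  variable the direction 1 recovers \<open>deriv\<close>.\<close>

lemma smooth_deriv [intro]:
  fixes f :: "real \<Rightarrow> real"
  assumes "smooth f"
  shows "smooth (deriv f)"
proof -
  have "frechet_derivative f (at x) 1 = deriv f x" for x
    using frechet_derivative_eqI[of f "(*) (deriv f x)" x] smooth_DERIV[OF assms, of x]
    by (simp add: has_field_derivative_def)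
  moreover have "Ck k (\<lambda>x. frechet_derivative f (at x) 1)" for k
    using assms unfolding smooth_def by (metis Ck.simps(2))
  ultimately show ?thesis
    by (simp add: smooth_def)
qed

lemma deriv_shift:
  fixes f :: "real \<Rightarrow> real"
  shows "deriv (\<lambda>y. f (y + a)) x = deriv f (x + a)"
  unfolding deriv_def DERIV_shift ..

section \<open>Periodic band matrices\<close>

text \<open>
  A matrix over Laurent series in \<open>\<lambda>\<inverse>\<close> is viewed as a doubly infinite matrix with integer indices
  that is invariant under shifting both indices by \<open>n\<close>: the coefficient of \<open>\<lambda>\<^sup>i\<close> at position
  \<open>(r, c)\<close> sits in row \<open>r\<close> and column \<open>c - i n\<close>.  Then \<open>J\<close> is the shift, \<open>r - c\<close> is the
  principal degree, and \<open>band_le n A d\<close> says that all components of degree above \<open>d\<close> vanish.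
\<close>

definition band :: "nat \<Rightarrow> real fls mat \<Rightarrow> int \<Rightarrow> int \<Rightarrow> real" where
  "band n A r c =
     fls_nth (A $$ (nat (r mod int n), nat (c mod int n))) (c div int n - r div int n)"

definition of_band :: "nat \<Rightarrow> (int \<Rightarrow> int \<Rightarrow> real) \<Rightarrow> real fls mat" where
  "of_band n e = Matrix.mat n n (\<lambda>(r, c). Abs_fls (\<lambda>p. e (int r) (int c + p * int n)))"

definition band_le :: "nat \<Rightarrow> real fls mat \<Rightarrow> int \<Rightarrow> bool" where
  "band_le n A d \<longleftrightarrow> (\<forall>r c. c < r - d \<longrightarrow> band n A r c = 0)"

lemma nat_mod_less: "0 < n \<Longrightarrow> nat (r mod int n) < n"
  by (simp add: nat_less_iff)

lemma fls_nth_eq_band: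
  assumes "r < n" "c < n"
  shows "fls_nth (A $$ (r, c)) p = band n A (int r) (int c + p * int n)"
  using assms by (simp add: band_def)

lemma band_periodic:
  "0 < n \<Longrightarrow> band n A (r + k * int n) (c + k * int n) = band n A r c"
  by (simp add: band_def)

lemma band_eqI:
  assumes "A \<in> carrier_mat n n" "B \<in> carrier_mat n n"
    and "\<And>r c. band n A r c = band n B r c"
  shows "A = B"
  using assms by (intro eq_matI fls_eqI) (auto simp: fls_nth_eq_band)

lemma of_band_carrier [simp, intro]: "of_band n e \<in> carrier_mat n n"
  by (simp add: of_band_def)

text \<open>\<open>Abs_fls\<close> is meaningful only if the coefficients vanish at all very
  negative indices. These are the high powers of \<lambda>, of degree above \<open>d\<close>, where
  \<open>bd\<close> makes \<open>e\<close> vanish.\<close>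

lemma band_of_band:
  assumes n: "0 < n"
    and per: "\<And>r c k. e (r + k * int n) (c + k * int n) = e r c"
    and bd: "\<And>r c. c < r - d \<Longrightarrow> e r c = 0"
  shows "band n (of_band n e) r c = e r c"
proof -
  define r0 c0 where "r0 = r mod int n" and "c0 = c mod int n"
  \<comment> \<open>For negative \<open>p\<close> one has \<open>p * n \<le> p\<close>, so this
    crude threshold already outweighs \<open>d\<close> and the spread of the residues
    \<open>r0\<close>, \<open>c0\<close>.\<close>
  have 0: "e r0 (c0 + p * int n) = 0" if "p < - (\<bar>d\<bar> + int n)" for p
  proof (rule bd)
    have "p * int n \<le> p * 1"
      using that n by (intro mult_left_mono_neg) auto
    moreover have "c0 < int n" "r0 \<ge> 0"
      using n by (auto simp: r0_def c0_def)
    ultimately show "c0 + p * int n < r0 - d"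
      using that by linarith
  qed
  have "band n (of_band n e) r c = e r0 (c0 + (c div int n - r div int n) * int n)"
    using n 0 unfolding band_def of_band_def
    by (simp add: nat_mod_less r0_def c0_def nth_Abs_fls_lower_bound[of "- (\<bar>d\<bar> + int n)"])
  also have "\<dots> = e (r0 + r div int n * int n) (c0 + (c div int n - r div int n) * int n + r div int n * int n)"
    by (rule per[symmetric])
  also have "r0 + r div int n * int n = r"
    by (simp add: r0_def)
  also have "c0 + (c div int n - r div int n) * int n + r div int n * int n = c"
    by (simp add: c0_def algebra_simps)
  finally show ?thesis .
qed

lemma band_add:
  "0 < n \<Longrightarrow> A \<in> carrier_mat n n \<Longrightarrow> B \<in> carrier_mat n n \<Longrightarrow>
    band n (A + B) r c = band n A r c + band n B r c"
  by (simp add: band_def nat_mod_less)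

lemma band_minus:
  "0 < n \<Longrightarrow> A \<in> carrier_mat n n \<Longrightarrow> B \<in> carrier_mat n n \<Longrightarrow>
    band n (A - B) r c = band n A r c - band n B r c"
  by (simp add: band_def nat_mod_less)

lemma band_zero: "0 < n \<Longrightarrow> band n (0\<^sub>m n n) r c = 0"
  by (simp add: band_def nat_mod_less)

lemma mod_div_eq_iff:
  fixes r c m :: int
  shows "r mod m = c mod m \<and> r div m = c div m \<longleftrightarrow> r = c"
  by (metis div_mult_mod_eq)

lemma band_one:
  assumes "0 < n"
  shows "band n (1\<^sub>m n) r c = (if r = c then 1 else 0)"
proof -
  have "nat (r mod int n) = nat (c mod int n) \<longleftrightarrow> r mod int n = c mod int n"
    using assms by (simp add: nat_eq_iff)
  then show ?thesis
    using assms mod_div_eq_iff[of r "int n" c]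
    by (auto simp: band_def nat_mod_less)
qed

text \<open>The entries of a row have different subdegrees. A range of summation common to all of
  them allows the sum over columns and the sum over exponents to be merged into one.\<close>

lemma fls_times_nth_superset:
  fixes f g :: "'a::comm_ring_1 fls"
  assumes f: "\<And>i. i < lo \<Longrightarrow> fls_nth f i = 0" and g: "\<And>i. i > hi \<Longrightarrow> fls_nth g (p - i) = 0"
  shows "fls_nth (f * g) p = (\<Sum>i=lo..hi. fls_nth f i * fls_nth g (p - i))"
proof (cases "f = 0 \<or> g = 0")
  case False
  then have "fls_nth f (fls_subdegree f) \<noteq> 0" "fls_nth g (fls_subdegree g) \<noteq> 0"
    by auto
  then have "lo \<le> fls_subdegree f" "p - fls_subdegree g \<le> hi"
    using f g[of "p - fls_subdegree g"] by force+
  then show ?thesis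
    unfolding fls_times_nth(2) by (intro sum.mono_neutral_left) auto
qed auto

lemma mult_mat_sum:
  "A \<in> carrier_mat n n \<Longrightarrow> B \<in> carrier_mat n n \<Longrightarrow> r < n \<Longrightarrow> c < n \<Longrightarrow>
    (A * B) $$ (r, c) = (\<Sum>s<n. A $$ (r, s) * B $$ (s, c))"
  by (auto simp: scalar_prod_def lessThan_atLeast0 intro!: sum.cong)

lemma fls_nth_sum: "fls_nth (\<Sum>i\<in>I. f i) p = (\<Sum>i\<in>I. fls_nth (f i) p)"
  by (induction I rule: infinite_finite_induct) auto

text \<open>Division by \<open>n\<close> identifies a pair (column, exponent) with one integer, so
  the matrix product and the Cauchy products of its entries merge into a single product of doubly
  infinite matrices, finite because of the degree bounds. The free \<open>S\<close> lets an index of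
  interest be included even when the natural range is empty.\<close>

lemma band_mult_superset:
  assumes n: "0 < n" and A: "A \<in> carrier_mat n n" and B: "B \<in> carrier_mat n n"
    and a: "band_le n A a" and b: "band_le n B b"
    and fin: "finite S" and sup: "{r - a..c + b} \<subseteq> S"
  shows "band n (A * B) r c = (\<Sum>s\<in>S. band n A r s * band n B s c)"
proof -
  define r0 c0 where "r0 = nat (r mod int n)" and "c0 = nat (c mod int n)"
  define \<rho> \<kappa> p where "\<rho> = r div int n" and "\<kappa> = c div int n" and "p = \<kappa> - \<rho>"
  \<comment> \<open>An exponent outside \<open>{-L..L}\<close> pushes one of the factors beyond its
    degree bound, whatever the column, and the blocks inside cover
    \<open>{r - a..c + b}\<close>.\<close>
  define L where "L = \<bar>a\<bar> + \<bar>b\<bar> + \<bar>p\<bar> + int n"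
  have r0: "r0 < n" "r = int r0 + \<rho> * int n" and c0: "c0 < n" "c = int c0 + \<kappa> * int n"
    using n by (simp_all add: r0_def c0_def \<rho>_def \<kappa>_def nat_mod_less)
  have small: "i * int n \<le> i" if "i < 0" for i
    using that n mult_left_mono_neg[of 1 "int n" i] by simp
  have A0: "fls_nth (A $$ (r0, s)) i = 0" if "i < - L" "s < n" for i s
  proof -
    have "int s + i * int n < int r0 - a"
      using small[of i] that unfolding L_def by linarith
    then show ?thesis
      using a that r0 by (simp add: fls_nth_eq_band band_le_def)
  qed
  have B0: "fls_nth (B $$ (s, c0)) (p - i) = 0" if "i > L" "s < n" for i s
  proof -
    have "int c0 + (p - i) * int n < int s - b"
      using small[of "p - i"] that c0 unfolding L_def by linarith
    then show ?thesis
      using b that c0 by (simp add: fls_nth_eq_band band_le_def)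
  qed
  have Aband: "fls_nth (A $$ (r0, s)) i = band n A r (int s + (i + \<rho>) * int n)" if "s < n" for s i
    using band_periodic[OF n, of A "int r0" \<rho> "int s + i * int n"] that r0
    by (simp add: fls_nth_eq_band algebra_simps)
  have Bband: "fls_nth (B $$ (s, c0)) (p - i) = band n B (int s + (i + \<rho>) * int n) c" if "s < n" for s i
    using band_periodic[OF n, of B "int s" "i + \<rho>" "int c0 + (p - i) * int n"] that c0
    by (simp add: fls_nth_eq_band algebra_simps p_def)
  let ?h = "\<lambda>s. band n A r s * band n B s c"
  let ?I = "{(\<rho> - L) * int n..<(\<rho> + L + 1) * int n}"
  have "band n (A * B) r c = fls_nth ((A * B) $$ (r0, c0)) p"
    by (simp add: band_def r0_def c0_def p_def \<rho>_def \<kappa>_def)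
  also have "\<dots> = (\<Sum>s<n. fls_nth (A $$ (r0, s) * B $$ (s, c0)) p)"
    using r0 c0 by (simp add: mult_mat_sum[OF A B] fls_nth_sum)
  also have "\<dots> = (\<Sum>s<n. \<Sum>i=-L..L. ?h (int s + (i + \<rho>) * int n))"
    by (intro sum.cong refl) (simp add: fls_times_nth_superset[OF A0 B0] Aband Bband)
  also have "\<dots> = (\<Sum>(s, i)\<in>{..<n} \<times> {-L..L}. ?h (int s + (i + \<rho>) * int n))"
    by (simp add: sum.cartesian_product)
  also have "\<dots> = (\<Sum>s\<in>?I. ?h s)"
  proof (rule sum.reindex_bij_witness[where i = "\<lambda>s. (nat (s mod int n), s div int n - \<rho>)"
        and j = "\<lambda>(s, i). int s + (i + \<rho>) * int n"])
    fix q assume "q \<in> {..<n} \<times> {-L..L}"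
    then obtain s i where q: "q = (s, i)" "s < n" "-L \<le> i" "i \<le> L" by auto
    have "- L * int n \<le> i * int n" "i * int n \<le> L * int n"
      using q by (auto intro!: mult_right_mono simp del: mult_minus_left)
    then have "int s + i * int n < int n + L * int n" "0 \<le> int s + i * int n + L * int n"
      using q by linarith+
    then show "(case q of (s, i) \<Rightarrow> int s + (i + \<rho>) * int n) \<in> ?I"
      using q by (auto simp: algebra_simps)
  next
    fix s assume s: "s \<in> ?I"
    have "(\<rho> - L) \<le> s div int n"
      using s n by (simp add: zdiv_mono1 div_int_pos_iff
          order.trans[OF _ zdiv_mono1[of "(\<rho> - L) * int n" s "int n"]])
    moreover have "s div int n < \<rho> + L + 1"
      using s n by (smt (verit) atLeastLessThan_iff div_mult_mod_eq mult_right_less_imp_less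
          of_nat_0_le_iff of_nat_0_less_iff pos_mod_sign)
    ultimately show "(nat (s mod int n), s div int n - \<rho>) \<in> {..<n} \<times> {-L..L}"
      using n by (auto simp: nat_mod_less)
  qed (use n in auto)
  also have "\<dots> = (\<Sum>s\<in>{r - a..c + b}. ?h s)"
  proof (rule sum.mono_neutral_right)
    have L: "(\<bar>a\<bar> + \<bar>b\<bar> + \<bar>p\<bar>) * 1 \<le> (\<bar>a\<bar> + \<bar>b\<bar> + \<bar>p\<bar>) * int n"
      using n by (intro mult_left_mono) auto
    have L1: "\<bar>a\<bar> \<le> L * int n"
      using L unfolding L_def by (simp add: algebra_simps) (smt (verit) mult_nonneg_nonneg of_nat_0_le_iff)
    have "(\<bar>b\<bar> + p) * int n \<le> L * int n"
      unfolding L_def by (intro mult_right_mono) auto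
    moreover have "b \<le> \<bar>b\<bar> * int n"
      using n mult_left_mono[of 1 "int n" "\<bar>b\<bar>"] by auto
    ultimately have L2: "b + p * int n \<le> L * int n"
      by (simp add: algebra_simps)
    show "{r - a..c + b} \<subseteq> ?I"
      using L1 L2 r0 c0 by (auto simp: algebra_simps p_def)
    show "\<forall>s\<in>?I - {r - a..c + b}. ?h s = 0"
      using a b by (auto simp: band_le_def)
  qed simp
  also have "\<dots> = (\<Sum>s\<in>S. ?h s)"
    using a b fin sup by (intro sum.mono_neutral_left) (auto simp: band_le_def)
  finally show ?thesis .
qed

lemmas band_mult = band_mult_superset[OF _ _ _ _ _ finite_atLeastAtMost_int order.refl]

lemma band_le_mult:
  assumes "0 < n" "A \<in> carrier_mat n n" "B \<in> carrier_mat n n" "band_le n A a" "band_le n B b"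
  shows "band_le n (A * B) (a + b)"
  unfolding band_le_def
proof (intro allI impI)
  fix r c assume "c < r - (a + b)"
  then show "band n (A * B) r c = 0"
    by (subst band_mult[OF assms]) auto
qed

text \<open>In the extreme degree the sum over \<open>s\<close> collapses to one term, as for
  leading coefficients of polynomials.\<close>

lemma band_mult_top:
  assumes "0 < n" "A \<in> carrier_mat n n" "B \<in> carrier_mat n n" "band_le n A a" "band_le n B b"
    and "c = r - a - b"
  shows "band n (A * B) r c = band n A r (r - a) * band n B (r - a) c"
  using band_mult[OF assms(1-5), of r c] assms(6) by simp

section \<open>Smooth families of band matrices\<close>

lemma square_mult_carrier [simp, intro]:
  "A \<in> carrier_mat n n \<Longrightarrow> B \<in> carrier_mat n n \<Longrightarrow> A * B \<in> carrier_mat n n"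
  by (rule mult_carrier_mat)

declare minus_carrier_mat [simp, intro]

text \<open>Every row is a translate of one of the rows \<open>0, ..., n - 1\<close>, so a periodic
  formula needs to be checked only there.\<close>

lemma band_eq_of_base:
  assumes n: "0 < n"
    and per: "\<And>r c k. e (r + k * int n) (c + k * int n) = e r c"
    and base: "\<And>r c p. r < n \<Longrightarrow> c < n \<Longrightarrow> fls_nth (A $$ (r, c)) p = e (int r) (int c + p * int n)"
  shows "band n A r c = e r c"
proof -
  have "band n A r c = e (r mod int n) (c mod int n + (c div int n - r div int n) * int n)"
    unfolding band_def using n by (subst base) (auto simp: nat_mod_less)
  also have "\<dots> = e (r mod int n + r div int n * int n)
      (c mod int n + (c div int n - r div int n) * int n + r div int n * int n)"
    by (rule per[symmetric])
  also have "c mod int n + (c div int n - r div int n) * int n + r div int n * int n = c"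
    by (simp add: algebra_simps)
  finally show ?thesis
    by simp
qed

lemma J_mat_carrier [simp, intro]: "J_mat n \<in> carrier_mat n n"
  by (simp add: J_mat_def e1n_mat_def b_mat_def)

lemma J_mat_dim [simp]: "dim_row (J_mat n) = n" "dim_col (J_mat n) = n"
  by (simp_all add: J_mat_def e1n_mat_def b_mat_def)

text \<open>The term e_{1n} \<lambda> lies in row 0 and column \<open>n - 1 - n = -1\<close>, where
  it continues the subdiagonal \<open>b\<close> across the block boundary; hence the shift.\<close>

lemma band_J_mat:
  assumes n: "2 \<le> n"
  shows "band n (J_mat n) r c = (if c = r - 1 then 1 else 0)"
proof (rule band_eq_of_base)
  fix r c :: nat and p :: int assume rc: "r < n" "c < n"
  have "int c + p * int n = int r - 1 \<longleftrightarrow> (p = 0 \<and> r = c + 1) \<or> (p = -1 \<and> r = 0 \<and> c = n - 1)"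
  proof -
    consider "p \<ge> 1" | "p = 0" | "p = -1" | "p \<le> -2" by linarith
    then show ?thesis
    proof cases
      case 1
      then have "1 * int n \<le> p * int n" by (intro mult_right_mono) auto
      then have "int c + p * int n \<noteq> int r - 1" using rc by linarith
      then show ?thesis using 1 by auto
    next
      case 4
      then have "p * int n \<le> -2 * int n" by (intro mult_right_mono) auto
      then have "int c + p * int n \<noteq> int r - 1" using rc by linarith
      then show ?thesis using 4 by auto
    qed (use rc n in auto)
  qed
  then show "fls_nth (J_mat n $$ (r, c)) p = (if int c + p * int n = int r - 1 then 1 else 0)"
    using rc n by (auto simp: J_mat_def e1n_mat_def b_mat_def)
qed (use n in auto)

lemma band_fls_const:
  assumes "0 < n" "M \<in> carrier_mat n n"
  shows "band n (map_mat fls_const M) r c =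
    (if c div int n = r div int n then M $$ (nat (r mod int n), nat (c mod int n)) else 0)"
  using assms by (auto simp: band_def nat_mod_less)

lemma band_smult_X_inv_one:
  assumes "0 < n"
  shows "band n (fls_X_inv \<cdot>\<^sub>m 1\<^sub>m n) r c = (if c = r - int n then 1 else 0)"
proof (rule band_eq_of_base)
  fix r c :: nat and p :: int assume rc: "r < n" "c < n"
  have "int c + p * int n = int r - int n \<longleftrightarrow> p = -1 \<and> r = c"
  proof
    assume *: "int c + p * int n = int r - int n"
    then have "(int c + (p + 1) * int n) div int n = int r div int n"
      by (simp add: algebra_simps)
    then have "p = -1"
      using rc by simp
    then show "p = -1 \<and> r = c"
      using * by simp
  qed auto
  then show "fls_nth ((fls_X_inv \<cdot>\<^sub>m 1\<^sub>m n) $$ (r, c)) p =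
      (if int c + p * int n = int r - int n then 1 else 0 :: real)"
    using rc by auto
qed (use assms in auto)

text \<open>The degree bound is uniform in \<open>x\<close>: an entry of a product is then a finite
  sum with the same range for all \<open>x\<close>, which can be differentiated termwise.\<close>

definition smooth_band :: "nat \<Rightarrow> int \<Rightarrow> (real \<Rightarrow> real fls mat) \<Rightarrow> bool" where
  "smooth_band n d F \<longleftrightarrow>
     (\<forall>x. F x \<in> carrier_mat n n \<and> band_le n (F x) d) \<and> (\<forall>r c. smooth (\<lambda>x. band n (F x) r c))"

definition band_deriv :: "nat \<Rightarrow> (real \<Rightarrow> real fls mat) \<Rightarrow> real \<Rightarrow> real fls mat" where
  "band_deriv n F x = of_band n (\<lambda>r c. deriv (\<lambda>y. band n (F y) r c) x)"

lemma band_deriv_carrier [simp, intro]: "band_deriv n F x \<in> carrier_mat n n"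
  by (simp add: band_deriv_def)

lemma band_band_deriv:
  assumes n: "0 < n" and F: "smooth_band n d F"
  shows "band n (band_deriv n F x) r c = deriv (\<lambda>y. band n (F y) r c) x"
  unfolding band_deriv_def
proof (rule band_of_band[OF n])
  fix r c :: int assume "c < r - d"
  then have "(\<lambda>y. band n (F y) r c) = (\<lambda>y. 0)"
    using F by (auto simp: smooth_band_def band_le_def)
  then show "deriv (\<lambda>y. band n (F y) r c) x = 0"
    by simp
qed (simp add: band_periodic[OF n])

lemma band_le_band_deriv:
  assumes n: "0 < n" and F: "smooth_band n d F"
  shows "band_le n (band_deriv n F x) d"
  unfolding band_le_def band_band_deriv[OF assms]
proof (intro allI impI)
  fix r c :: int assume "c < r - d"
  then have "(\<lambda>y. band n (F y) r c) = (\<lambda>y. 0)"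
    using F by (auto simp: smooth_band_def band_le_def)
  then show "deriv (\<lambda>y. band n (F y) r c) x = 0"
    by simp
qed

lemma smooth_band_mult:
  assumes "0 < n" "smooth_band n a F" "smooth_band n b G"
  shows "smooth_band n (a + b) (\<lambda>x. F x * G x)"
  using assms
  by (auto simp: smooth_band_def band_mult[where a = a and b = b] intro!: band_le_mult smooth_sum)

lemma smooth_band_const:
  assumes "A \<in> carrier_mat n n" "band_le n A d"
  shows "smooth_band n d (\<lambda>x. A)"
  using assms by (auto simp: smooth_band_def)

lemma band_deriv_const:
  assumes "0 < n" "A \<in> carrier_mat n n" "band_le n A d"
  shows "band_deriv n (\<lambda>x. A) x = 0\<^sub>m n n"
  using assms
  by (intro band_eqI) (auto simp: band_band_deriv[OF _ smooth_band_const] band_zero)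

lemma band_deriv_mult:
  assumes n: "0 < n" and F: "smooth_band n a F" and G: "smooth_band n b G"
  shows "band_deriv n (\<lambda>x. F x * G x) x = band_deriv n F x * G x + F x * band_deriv n G x"
proof (rule band_eqI)
  have car: "F x \<in> carrier_mat n n" "band_le n (F x) a" "G x \<in> carrier_mat n n" "band_le n (G x) b" for x
    using F G by (auto simp: smooth_band_def)
  have sm: "smooth (\<lambda>x. band n (F x) r c)" "smooth (\<lambda>x. band n (G x) r c)" for r c
    using F G by (auto simp: smooth_band_def)
  show "band_deriv n F x * G x + F x * band_deriv n G x \<in> carrier_mat n n"
    using car by auto
  fix r c
  have "band n (band_deriv n (\<lambda>x. F x * G x) x) r c
      = deriv (\<lambda>x. \<Sum>s\<in>{r - a..c + b}. band n (F x) r s * band n (G x) s c) x"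
    by (simp add: band_band_deriv[OF n smooth_band_mult[OF n F G]] band_mult[OF n car(1,3,2,4)])
  also have "\<dots> = (\<Sum>s\<in>{r - a..c + b}. deriv (\<lambda>y. band n (F y) r s) x * band n (G x) s c
      + deriv (\<lambda>y. band n (G y) s c) x * band n (F x) r s)"
    by (intro DERIV_imp_deriv DERIV_sum DERIV_mult smooth_DERIV sm)
  also have "\<dots> = band n (band_deriv n F x * G x + F x * band_deriv n G x) r c"
    using car n
    by (subst band_add)
       (auto simp: band_mult[where a = a and b = b] band_le_band_deriv[OF n F]
         band_le_band_deriv[OF n G] band_band_deriv[OF n F] band_band_deriv[OF n G]
         sum.distrib mult.commute intro!: sum.cong)
  finally show "band n (band_deriv n (\<lambda>x. F x * G x) x) r c
      = band n (band_deriv n F x * G x + F x * band_deriv n G x) r c" .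
qed auto

lemma lam_coeff_index:
  "A \<in> carrier_mat n n \<Longrightarrow> r < n \<Longrightarrow> c < n \<Longrightarrow>
    lam_coeff i A $$ (r, c) = band n A (int r) (int c - i * int n)"
  by (simp add: lam_coeff_def fls_nth_eq_band)

lemma lam_coeff_carrier [simp, intro]:
  "A \<in> carrier_mat n n \<Longrightarrow> lam_coeff i A \<in> carrier_mat n n"
  by (simp add: lam_coeff_def)

lemma lam_coeff_eq_zero_imp:
  assumes "A \<in> carrier_mat n n" "\<And>i. lam_coeff i A = 0\<^sub>m n n"
  shows "A = 0\<^sub>m n n"
proof (rule eq_matI)
  fix r c assume "r < dim_row (0\<^sub>m n n :: real fls mat)" "c < dim_col (0\<^sub>m n n :: real fls mat)"
  then have rc: "r < n" "c < n" by auto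
  have "fls_nth (A $$ (r, c)) p = 0" for p
    using arg_cong[OF assms(2)[of "- p"], of "\<lambda>M. M $$ (r, c)"] rc assms(1)
    by (simp add: lam_coeff_def)
  then show "A $$ (r, c) = 0\<^sub>m n n $$ (r, c)"
    using rc by (auto intro: fls_eqI)
qed (use assms in auto)

lemma lam_coeff_add:
  "A \<in> carrier_mat n n \<Longrightarrow> B \<in> carrier_mat n n \<Longrightarrow>
    lam_coeff i (A + B) = lam_coeff i A + lam_coeff i B"
  by (intro eq_matI) (auto simp: lam_coeff_def)

text \<open>\<open>is_Y\<close> states its differential equation for each power of \<lambda>
  separately; this makes it a single equation between bands.\<close>

lemma mat_deriv_lam_coeff:
  assumes n: "0 < n" and Y: "smooth_band n d Y"
  shows "mat_deriv n (\<lambda>y. lam_coeff i (Y y)) x = lam_coeff i (band_deriv n Y x)"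
proof -
  have "Y y \<in> carrier_mat n n" for y
    using Y by (simp add: smooth_band_def)
  then show ?thesis
    by (intro eq_matI)
       (auto simp: mat_deriv_def lam_coeff_index[where n = n] band_band_deriv[OF n Y] carrier_matD[OF lam_coeff_carrier[OF band_deriv_carrier]])
qed

lemma commutator_carrier [simp, intro]:
  "A \<in> carrier_mat n n \<Longrightarrow> B \<in> carrier_mat n n \<Longrightarrow> commutator A B \<in> carrier_mat n n"
  by (auto simp: commutator_def)

lemma pow_mat_carrier [simp, intro]: "A \<in> carrier_mat n n \<Longrightarrow> A ^\<^sub>m k \<in> carrier_mat n n"
  by (induction k) auto

section \<open>Uniqueness of the series Y in the principal grading\<close>

locale kdv_potential =
  fixes n :: nat and u :: "real \<Rightarrow> real mat"
  assumes n2: "2 \<le> n" and u_smooth: "smooth_mat n u" and u_V: "\<And>x. u x \<in> V_space n"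
begin

lemma n0: "0 < n"
  using n2 by simp

lemma u_carrier [simp, intro]: "u x \<in> carrier_mat n n"
  using u_smooth by (simp add: smooth_mat_def)

lemma u_index:
  assumes "r < n" "c < n" "r = n - 1 \<or> c \<noteq> n - 1"
  shows "u x $$ (r, c) = 0"
  using u_V[of x] assms by (auto simp: V_space_def u_mat_def)

definition conn :: "real \<Rightarrow> real fls mat" where
  "conn x = J_mat n + map_mat fls_const (u x)"

lemma conn_carrier [simp, intro]: "conn x \<in> carrier_mat n n"
  by (simp add: conn_def)

lemma conn_dim [simp]: "dim_row (conn x) = n" "dim_col (conn x) = n"
  using conn_carrier[of x] by (auto simp del: conn_carrier)

definition U :: "int \<Rightarrow> real \<Rightarrow> real" where
  "U r x = u x $$ (nat (r mod int n), n - 1)"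

text \<open>The last column of the diagonal block that contains row \<open>r\<close>, the only place
  in that row where \<open>u\<close> can have an entry.\<close>

definition last_col :: "int \<Rightarrow> int" where
  "last_col r = r div int n * int n + int n - 1"

lemma last_col_ge: "r \<le> last_col r"
proof -
  have "r = r div int n * int n + r mod int n" "r mod int n < int n"
    using n0 by simp_all
  then show ?thesis
    unfolding last_col_def by linarith
qed

lemma eq_last_col_iff: "c = last_col r \<longleftrightarrow> c div int n = r div int n \<and> c mod int n = int n - 1"
proof
  have n': "int n \<noteq> 0"
    using n0 by simp
  assume "c = last_col r"
  then have c: "c = (int n - 1) + r div int n * int n"
    by (simp add: last_col_def)
  show "c div int n = r div int n \<and> c mod int n = int n - 1"
    unfolding c div_mult_self1[OF n'] mod_mult_self1
    using n0 by (simp add: div_pos_pos_trivial mod_pos_pos_trivial del: minus_mod_self2 minus_mod_self1 div_diff)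
next
  assume "c div int n = r div int n \<and> c mod int n = int n - 1"
  then show "c = last_col r"
    using div_mult_mod_eq[of c "int n"] by (simp add: last_col_def)
qed

lemma band_const_u:
  "band n (map_mat fls_const (u x)) r c = (if c = last_col r then U r x else 0)"
proof -
  have "nat (c mod int n) = n - 1 \<longleftrightarrow> c mod int n = int n - 1"
    using n0 by (auto simp: nat_eq_iff)
  then show ?thesis
    using n0 by (auto simp: band_fls_const eq_last_col_iff U_def nat_mod_less intro!: u_index)
qed

lemma band_conn:
  "band n (conn x) r c = (if c = r - 1 then 1 else if c = last_col r then U r x else 0)"
  using last_col_ge[of r] n0 n2
  by (auto simp: conn_def band_add band_J_mat band_const_u)

lemma band_le_conn: "band_le n (conn x) 1"
  using last_col_ge by (auto simp: band_le_def band_conn) (smt (verit))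

text \<open>The bound \<open>2 * n\<close> is crude: an entry of the coefficient of \<lambda> has
  degree r - c + n < 2n, and \<open>is_Y_top\<close> later lowers the bound to 1. Of the prescribed
  leading coefficient only the entry at \<open>(0, -1)\<close> is kept; it selects the right root of
  Y^n = \<lambda>.\<close>

lemma is_YD:
  assumes "is_Y n u Y"
  shows "smooth_band n (2 * int n) Y"
    and "band_deriv n Y x + commutator (conn x) (Y x) = 0\<^sub>m n n"
    and "Y x ^\<^sub>m n = fls_X_inv \<cdot>\<^sub>m 1\<^sub>m n"
    and "band n (Y x) 0 (-1) = 1"
proof -
  have car: "Y x \<in> carrier_mat n n" for x
    using assms by (simp add: is_Y_def)
  have band: "band n (Y x) r c = lam_coeff (r div int n - c div int n) (Y x)
      $$ (nat (r mod int n), nat (c mod int n))" for x r c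
    using car[of x] n0 by (simp add: band_def lam_coeff_def nat_mod_less)
  have "band n (Y x) r c = 0" if "c < r - 2 * int n" for x r c
  proof -
    have "c div int n \<le> (r + (- 2) * int n) div int n"
      using that n0 by (intro zdiv_mono1) auto
    also have "\<dots> = r div int n - 2"
      using n0 by (subst div_mult_self1) auto
    finally have "r div int n - c div int n > 1"
      by simp
    then have "lam_coeff (r div int n - c div int n) (Y x) = 0\<^sub>m n n"
      using assms by (simp add: is_Y_def)
    then show ?thesis
      using n0 by (simp add: band nat_mod_less)
  qed
  moreover have "smooth (\<lambda>x. band n (Y x) r c)" for r c
    using assms n0 by (simp add: band nat_mod_less is_Y_def smooth_mat_def)
  ultimately show Y: "smooth_band n (2 * int n) Y"
    using car by (auto simp: smooth_band_def band_le_def)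
  show "band_deriv n Y x + commutator (conn x) (Y x) = 0\<^sub>m n n"
  proof (rule lam_coeff_eq_zero_imp)
    fix i
    show "lam_coeff i (band_deriv n Y x + commutator (conn x) (Y x)) = 0\<^sub>m n n"
      using assms[unfolded is_Y_def] mat_deriv_lam_coeff[OF n0 Y, of i x, symmetric] car
      by (simp add: lam_coeff_add[where n = n] conn_def)
  qed (use car in auto)
  show "Y x ^\<^sub>m n = fls_X_inv \<cdot>\<^sub>m 1\<^sub>m n"
    using assms by (simp add: is_Y_def)
  have "lam_coeff 1 (Y x) $$ (0, n - 1) = 1"
    using assms n0 by (simp add: is_Y_def e1n_mat_def)
  then show "band n (Y x) 0 (-1) = 1"
    using n0 car[of x] by (simp add: lam_coeff_index[where n = n])
qed

text \<open>One degree above the top of \<open>W\<close> the derivative and \<open>u\<close>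
  contribute nothing, so the equation says that the top component commutes with J. Commuting with
  the shift means being constant along the diagonal.\<close>

lemma top_component_const:
  assumes W: "smooth_band n (- m) W"
    and eq: "\<And>x. band_deriv n W x + commutator (conn x) (W x) = 0\<^sub>m n n"
  shows "band n (W x) r (r + m) = band n (W x) 0 m"
proof -
  have car: "W x \<in> carrier_mat n n" "band_le n (W x) (- m)" for x
    using W by (auto simp: smooth_band_def)
  have step: "band n (W x) r (r + m) = band n (W x) (r - 1) (r - 1 + m)" for r
  proof -
    have "(\<lambda>y. band n (W y) r (r - 1 + m)) = (\<lambda>y. 0)"
      using car by (auto simp: band_le_def)
    then have "band n (band_deriv n W x) r (r - 1 + m) = 0"
      by (simp add: band_band_deriv[OF n0 W])
    moreover have "band n (conn x * W x) r (r - 1 + m) = band n (W x) (r - 1) (r - 1 + m)"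
      by (subst band_mult_top[OF n0 conn_carrier car(1) band_le_conn car(2)]) (auto simp: band_conn)
    moreover have "band n (W x * conn x) r (r - 1 + m) = band n (W x) r (r + m)"
      by (subst band_mult_top[OF n0 car(1) conn_carrier car(2) band_le_conn]) (auto simp: band_conn)
    moreover have "band n (band_deriv n W x + commutator (conn x) (W x)) r (r - 1 + m) = 0"
      unfolding eq by (simp add: band_zero[OF n0])
    ultimately show ?thesis
      using car(1) n0 by (simp add: commutator_def band_add[of n "band_deriv n W x"] band_minus)
  qed
  show ?thesis
  proof (induction r rule: int_induct[where k = 0])
    case (step1 i)
    then show ?case using step[of "i + 1"] by (simp add: algebra_simps)
  next
    case (step2 i)
    then show ?case using step[of i] by (simp add: algebra_simps)
  qed simp
qed

end

lemma band_pow_top: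
  assumes n: "0 < n" and A: "A \<in> carrier_mat n n" and a: "band_le n A a"
    and top: "\<And>r. band n A r (r - a) = y"
  shows "band_le n (A ^\<^sub>m k) (int k * a) \<and> (\<forall>r. band n (A ^\<^sub>m k) r (r - int k * a) = y ^ k)"
proof (induction k)
  case 0
  then show ?case
    using n A by (auto simp: band_le_def band_one)
next
  case (Suc k)
  have "band_le n (A ^\<^sub>m Suc k) (int k * a + a)"
    using Suc n A a by (auto intro!: band_le_mult)
  moreover have "band n (A ^\<^sub>m Suc k) r (r - (int k * a + a)) = y ^ Suc k" for r
    using band_mult_top[OF n pow_mat_carrier[OF A] A conjunct1[OF Suc] a, of "r - (int k * a + a)" r]
      Suc top[of "r - int k * a"] by (simp add: algebra_simps)
  ultimately show ?case
    by (simp add: algebra_simps)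
qed

text \<open>The linearisation of the power map at J: with A^(k+1) - B^(k+1) = A^k (A - B) + (A^k -
  B^k) B, each step adds one more \<delta>, because the top components of \<open>A\<close> and
  \<open>B\<close> are both J.\<close>

lemma band_pow_diff_top:
  assumes n: "0 < n" and A: "A \<in> carrier_mat n n" "band_le n A 1" "\<And>r. band n A r (r - 1) = 1"
    and B: "B \<in> carrier_mat n n" "band_le n B 1" "\<And>r. band n B r (r - 1) = 1"
    and D: "band_le n (A - B) (- m)" "\<And>r. band n (A - B) r (r + m) = \<delta>"
  shows "band_le n (A ^\<^sub>m k - B ^\<^sub>m k) (int k - 1 - m) \<and>
    (\<forall>r. band n (A ^\<^sub>m k - B ^\<^sub>m k) r (r - (int k - 1 - m)) = real k * \<delta>)"
proof (induction k)
  case 0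
  then show ?case
    using n A B by (auto simp: band_le_def band_minus band_one)
next
  case (Suc k)
  let ?D = "A ^\<^sub>m k - B ^\<^sub>m k"
  have pow: "band_le n (A ^\<^sub>m k) (int k)" "band n (A ^\<^sub>m k) r (r - int k) = 1" for r
    using band_pow_top[OF n A(1,2), of 1 k] A by auto
  have eq: "A ^\<^sub>m Suc k - B ^\<^sub>m Suc k = A ^\<^sub>m k * (A - B) + ?D * B"
    using A(1) B(1)
    by (simp add: mult_minus_distrib_mat[where n = n and nr = n and nc = n]
        minus_mult_distrib_mat[where n = n and nr = n and nc = n])
       (auto intro!: eq_matI)
  have car: "A ^\<^sub>m k * (A - B) \<in> carrier_mat n n" "?D * B \<in> carrier_mat n n"
    using A B by auto
  have le1: "band_le n (A ^\<^sub>m k * (A - B)) (int k + - m)"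
    using n A B D pow by (intro band_le_mult) auto
  have le2: "band_le n (?D * B) (int k - 1 - m + 1)"
    using n A B Suc by (intro band_le_mult) auto
  have "band_le n (A ^\<^sub>m Suc k - B ^\<^sub>m Suc k) (int k - m)"
    using le1 le2 car n unfolding eq by (auto simp: band_le_def band_add)
  moreover have "band n (A ^\<^sub>m Suc k - B ^\<^sub>m Suc k) r (r - (int k - m)) = real (Suc k) * \<delta>" for r
  proof -
    have "band n (A ^\<^sub>m k * (A - B)) r (r - (int k - m)) = \<delta>"
      using band_mult_top[OF n _ _ pow(1) D(1), of "r - (int k - m)" r] A B pow(2)[of r]
        D(2)[of "r - int k"] by (simp add: algebra_simps)
    moreover have "band n (?D * B) r (r - (int k - m)) = real k * \<delta>"
      using band_mult_top[OF n _ _ conjunct1[OF Suc] B(2), of "r - (int k - m)" r] A B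
        spec[OF conjunct2[OF Suc], of r] B(3)[of "r - (int k - 1 - m)"] by (simp add: algebra_simps)
    ultimately show ?thesis
      unfolding eq using n car by (simp add: band_add algebra_simps)
  qed
  ultimately show ?case
    by simp
qed

context kdv_potential
begin

text \<open>A top component y J^d with d > 1 would give Y^n the top component y^n in degree n d > n,
  where \<lambda> has none; so y = 0 and the bound drops. In degree 1 the multiple is read off at
  \<open>(0, -1)\<close>.\<close>

lemma is_Y_top:
  assumes Y: "is_Y n u Y"
  shows "smooth_band n 1 Y" and "band n (Y x) r (r - 1) = 1"
proof -
  note YD = is_YD[OF Y]
  have car: "Y x \<in> carrier_mat n n" and sm: "smooth (\<lambda>x. band n (Y x) r c)" for x r c
    using YD(1) by (auto simp: smooth_band_def)
  \<comment> \<open>The \<open>max\<close> lets the induction idle once the bound 1 is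
    reached.\<close>
  have "smooth_band n (max 1 (2 * int n - int k)) Y" for k
  proof (induction k)
    case 0
    then show ?case using YD(1) n2 by (simp add: max_def)
  next
    case (Suc k)
    show ?case
    proof (cases "2 * int n - int k > 1")
      case True
      define d where "d = 2 * int n - int k"
      have d: "d > 1" "max 1 (2 * int n - int (Suc k)) = d - 1"
        using True by (auto simp: d_def)
      have sb: "smooth_band n (- (- d)) Y"
        using Suc True by (simp add: d_def max_def)
      have "band n (Y x) r c = 0" if "c < r - (d - 1)" for x r c
      proof (cases "c = r - d")
        case True
        have const: "band n (Y x) r (r - d) = band n (Y x) 0 (- d)" for r
          using top_component_const[OF sb YD(2), of x r] by simp
        have "band n (Y x ^\<^sub>m n) 0 (0 - int n * d) = band n (Y x) 0 (- d) ^ n"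
          by (rule conjunct2[OF band_pow_top[OF n0 car _ const], THEN spec])
             (use sb in \<open>simp add: smooth_band_def\<close>)
        moreover have "band n (Y x ^\<^sub>m n) 0 (0 - int n * d) = 0"
          using n0 d(1) unfolding YD(3) by (simp add: band_smult_X_inv_one)
        ultimately have "band n (Y x) 0 (- d) = 0"
          by simp
        then show ?thesis
          using const[of r] True by simp
      next
        case False
        then have "c < r - d"
          using that by simp
        then show ?thesis
          using sb by (auto simp: smooth_band_def band_le_def)
      qed
      then show ?thesis
        using car sm unfolding d(2) by (auto simp: smooth_band_def band_le_def)
    next
      case False
      then have "max 1 (2 * int n - int (Suc k)) = max 1 (2 * int n - int k)" by simp
      then show ?thesis using Suc by simp
    qed
  qed
  from this[of "2 * n"] show 1: "smooth_band n 1 Y"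
    by simp
  then show "band n (Y x) r (r - 1) = 1"
    using top_component_const[OF _ YD(2), of "-1" x r] YD(4)[of x] by simp
qed

text \<open>If the difference starts with \<delta> J^(-m), the difference of the \<open>n\<close>-th
  powers starts with n \<delta> J^(n-1-m). Both powers equal \<lambda>, so \<delta> vanishes and the
  difference drops by one more degree.\<close>

lemma is_Y_unique:
  assumes Y: "is_Y n u Y" and Y': "is_Y n u Y'"
  shows "Y = Y'"
proof -
  note YD = is_YD[OF Y] is_Y_top[OF Y] and YD' = is_YD[OF Y'] is_Y_top[OF Y']
  define D where "D = (\<lambda>x. Y x - Y' x)"
  have car: "Y x \<in> carrier_mat n n" "Y' x \<in> carrier_mat n n" "D x \<in> carrier_mat n n" for x
    using YD(1) YD'(1) by (auto simp: smooth_band_def D_def)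
  have bD: "band n (D x) r c = band n (Y x) r c - band n (Y' x) r c" for x r c
    using car n0 by (simp add: D_def band_minus)
  have sm: "smooth (\<lambda>x. band n (Y x) r c)" "smooth (\<lambda>x. band n (Y' x) r c)" for r c
    using YD(1) YD'(1) by (auto simp: smooth_band_def)
  have smD: "smooth (\<lambda>x. band n (D x) r c)" for r c
    unfolding bD by (intro smooth_diff sm)
  have eq: "band_deriv n D x + commutator (conn x) (D x) = 0\<^sub>m n n" if sb: "smooth_band n d D" for d x
  proof (rule band_eqI)
    fix r c
    have "deriv (\<lambda>y. band n (D y) r c) x
        = deriv (\<lambda>y. band n (Y y) r c) x - deriv (\<lambda>y. band n (Y' y) r c) x"
      unfolding bD by (intro DERIV_imp_deriv DERIV_diff smooth_DERIV sm)
    moreover have "commutator (conn x) (D x) = commutator (conn x) (Y x) - commutator (conn x) (Y' x)"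
      using car[of x] unfolding commutator_def D_def
      by (simp add: mult_minus_distrib_mat[where n = n and nr = n and nc = n]
          minus_mult_distrib_mat[where n = n and nr = n and nc = n])
         (auto intro!: eq_matI)
    moreover have "deriv (\<lambda>y. band n (Y y) r c) x + band n (commutator (conn x) (Y x)) r c = 0"
      "deriv (\<lambda>y. band n (Y' y) r c) x + band n (commutator (conn x) (Y' x)) r c = 0"
      using arg_cong[OF YD(2), of "\<lambda>M. band n M r c" x] arg_cong[OF YD'(2), of "\<lambda>M. band n M r c" x] car n0
      by (simp_all add: band_add band_zero band_band_deriv[OF n0 YD(1)] band_band_deriv[OF n0 YD'(1)])
    ultimately show "band n (band_deriv n D x + commutator (conn x) (D x)) r c = band n (0\<^sub>m n n) r c"
      using car n0 by (simp add: band_add band_zero band_minus band_band_deriv[OF n0 sb])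
  qed (use car in auto)
  have D: "smooth_band n (- int m) D" for m
  proof (induction m)
    case 0
    have "band n (D x) r c = 0" if "c < r" for x r c
    proof (cases "c = r - 1")
      case True
      then show ?thesis using YD(6) YD'(6) by (simp add: bD)
    next
      case False
      then show ?thesis
        using that YD(5) YD'(5) by (simp add: bD smooth_band_def band_le_def)
    qed
    then show ?case
      using car smD by (simp add: smooth_band_def band_le_def)
  next
    case (Suc m)
    have "band n (D x) r c = 0" if "c < r + 1 + int m" for x r c
    proof (cases "c = r + int m")
      case True
      have const: "band n (Y x - Y' x) r (r + int m) = band n (D x) 0 (int m)" for r
        using top_component_const[OF Suc eq[OF Suc], of x r] by (simp add: D_def)
      have le: "band_le n (Y x) 1" "band_le n (Y' x) 1" "band_le n (Y x - Y' x) (- int m)"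
        using YD(5) YD'(5) Suc by (auto simp: smooth_band_def D_def)
      have "band n (Y x ^\<^sub>m n - Y' x ^\<^sub>m n) 0 (0 - (int n - 1 - int m)) = real n * band n (D x) 0 (int m)"
        using band_pow_diff_top[OF n0 car(1) le(1) YD(6) car(2) le(2) YD'(6) le(3) const, of n] by blast
      moreover have "Y x ^\<^sub>m n - Y' x ^\<^sub>m n = 0\<^sub>m n n"
        unfolding YD(3) YD'(3) by (intro eq_matI) auto
      ultimately have "band n (D x) 0 (int m) = 0"
        using n0 by (simp add: band_zero)
      then show ?thesis
        using const[of r] True by (simp add: D_def)
    next
      case False
      then show ?thesis
        using that Suc by (simp add: smooth_band_def band_le_def)
    qed
    then show ?case
      using car smD by (simp add: smooth_band_def band_le_def)
  qed
  \<comment> \<open>Each single entry lies in a fixed degree, hence is cleared after finitely many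
    steps.\<close>
  have "band n (D x) r c = 0" for x r c
  proof -
    have "c < r + int (nat (c - r + 1))" by simp
    then show ?thesis
      using D[of "nat (c - r + 1)"] by (simp add: smooth_band_def band_le_def)
  qed
  then have "band n (Y x) r c = band n (Y' x) r c" for x r c
    by (simp add: bD)
  then show ?thesis
    using band_eqI[OF car(1,2)] by auto
qed

end

section \<open>The gauge transformation\<close>

lemma sum_int_interval:
  fixes r c :: int
  assumes "r \<le> c"
  shows "(\<Sum>s\<in>{r..c}. h s) = (\<Sum>k\<le>nat (c - r). h (r + int k))"
  by (rule sum.reindex_bij_witness[where i = "\<lambda>k. r + int k" and j = "\<lambda>s. nat (s - r)"])
     (use assms in auto)

context kdv_potential
begin

lemma band_J_mult:
  assumes "A \<in> carrier_mat n n" "band_le n A d"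
  shows "band n (J_mat n * A) r c = band n A (r - 1) c"
proof -
  have "band_le n (J_mat n) 1"
    using n2 by (simp add: band_le_def band_J_mat)
  \<comment> \<open>The range \<open>{r - 1..c + d}\<close> may be empty; with \<open>r - 1\<close>
    inserted the sum can be evaluated without a case distinction.\<close>
  from band_mult_superset[OF n0 J_mat_carrier assms(1) this assms(2),
      where S = "insert (r - 1) {r - 1..c + d}"]
  have "band n (J_mat n * A) r c
      = (\<Sum>s\<in>insert (r - 1) {r - 1..c + d}. band n (J_mat n) r s * band n A s c)"
    by auto
  also have "\<dots> = (\<Sum>s\<in>insert (r - 1) {r - 1..c + d}. if s = r - 1 then band n A s c else 0)"
    using n2 by (intro sum.cong) (auto simp: band_J_mat)
  also have "\<dots> = band n A (r - 1) c"
    by (subst sum.delta) auto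
  finally show ?thesis .
qed

lemma band_mult_J:
  assumes "A \<in> carrier_mat n n" "band_le n A d"
  shows "band n (A * J_mat n) r c = band n A r (c + 1)"
proof -
  have "band_le n (J_mat n) 1"
    using n2 by (simp add: band_le_def band_J_mat)
  from band_mult_superset[OF n0 assms(1) J_mat_carrier assms(2) this,
      where S = "insert (c + 1) {r - d..c + 1}"]
  have "band n (A * J_mat n) r c
      = (\<Sum>s\<in>insert (c + 1) {r - d..c + 1}. band n A r s * band n (J_mat n) s c)"
    by auto
  also have "\<dots> = (\<Sum>s\<in>insert (c + 1) {r - d..c + 1}. if s = c + 1 then band n A r s else 0)"
    using n2 by (intro sum.cong) (auto simp: band_J_mat)
  also have "\<dots> = band n A r (c + 1)"
    by (subst sum.delta) auto
  finally show ?thesis .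
qed

lemma band_conn_mult:
  assumes "A \<in> carrier_mat n n" "band_le n A d"
  shows "band n (conn x * A) r c = band n A (r - 1) c + U r x * band n A (last_col r) c"
proof -
  let ?S = "insert (r - 1) (insert (last_col r) {r - 1..c + d})"
  have "band n (conn x * A) r c = (\<Sum>s\<in>?S. band n (conn x) r s * band n A s c)"
    by (rule band_mult_superset[OF n0 conn_carrier assms(1) band_le_conn assms(2)]) auto
  also have "\<dots> = (\<Sum>s\<in>?S. (if s = r - 1 then band n A s c else 0)
      + (if s = last_col r then U r x * band n A s c else 0))"
    using last_col_ge[of r] by (intro sum.cong) (auto simp: band_conn)
  also have "\<dots> = band n A (r - 1) c + U r x * band n A (last_col r) c"
    unfolding sum.distrib by (subst (1 2) sum.delta) auto
  finally show ?thesis .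
qed

text \<open>
  The gauge transformation \<open>T\<close>, of principal degree at most \<open>0\<close>, and the series \<open>f\<close> in
  \<open>J\<inverse>\<close> with \<open>T\<^sub>x + (J + u) T = T (J + f)\<close>.  In degree \<open>- m\<close> this equation reads
  \<open>t\<^sub>m\<^sub>+\<^sub>1 r - t\<^sub>m\<^sub>+\<^sub>1 (r - 1) = \<rho>\<^sub>m r - f\<^sub>m\<close> with \<open>r\<close> taken modulo \<open>n\<close>, so \<open>f\<^sub>m\<close> has to be the
  mean of \<open>\<rho>\<^sub>m\<close>.
\<close>

function (sequential) tc :: "nat \<Rightarrow> nat \<Rightarrow> real \<Rightarrow> real"
  and \<rho>c :: "nat \<Rightarrow> nat \<Rightarrow> real \<Rightarrow> real"
  and fc :: "nat \<Rightarrow> real \<Rightarrow> real" where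
  "tc 0 r = (\<lambda>x. 1)"
| "tc (Suc m) r = (\<lambda>x. \<Sum>s\<in>{..r}. \<rho>c m s x - fc m x)"
| "\<rho>c m s = (\<lambda>x. deriv (tc m s) x
     + (if n - 1 - s \<le> m then u x $$ (s, n - 1) * tc (m - (n - 1 - s)) (n - 1) x else 0)
     - (\<Sum>k\<in>{..<m}. fc k x * tc (m - k) s x))"
| "fc m = (\<lambda>x. (1 / real n) * (\<Sum>s\<in>{..<n}. \<rho>c m s x))"
  by pat_completeness auto
termination
  \<comment> \<open>The order of computation is \<open>tc m\<close>, \<open>\<rho>c m\<close>,
    \<open>fc m\<close>, then \<open>tc (Suc m)\<close>, whence the weights \<open>3 * m\<close>,
    \<open>3 * m + 1\<close>, \<open>3 * m + 2\<close>.\<close>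
  by (relation "measure (case_sum (\<lambda>(m, r). 3 * m) (case_sum (\<lambda>(m, s). 3 * m + 1) (\<lambda>m. 3 * m + 2)))")
     auto

declare \<rho>c.simps [simp del] fc.simps [simp del] tc.simps(2) [simp del]

lemma smooth_coeffs:
  "(\<forall>s<n. smooth (tc m s)) \<and> (\<forall>s<n. smooth (\<rho>c m s)) \<and> smooth (fc m)"
proof (induction m rule: less_induct)
  case (less m)
  have t: "smooth (tc m s)" if "s < n" for s
  proof (cases m)
    case (Suc m')
    then show ?thesis
      using less[of m'] that by (auto simp: tc.simps(2) intro!: smooth_sum smooth_diff)
  qed simp
  have t': "smooth (tc k s)" if "s < n" "k \<le> m" for s k
    using less[of k] t that by (cases "k = m") auto
  have \<rho>: "smooth (\<rho>c m s)" if "s < n" for s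
  proof -
    have "smooth (\<lambda>x. if n - 1 - s \<le> m then u x $$ (s, n - 1) * tc (m - (n - 1 - s)) (n - 1) x else 0)"
      using that t' u_smooth by (intro smooth_if smooth_mult) (auto simp: smooth_mat_def)
    then show ?thesis
      unfolding \<rho>c.simps using that t less t' by (auto intro!: smooth_add smooth_diff smooth_sum smooth_mult smooth_deriv)
  qed
  moreover have "smooth (fc m)"
    unfolding fc.simps using \<rho> by (intro smooth_mult smooth_const smooth_sum) auto
  ultimately show ?case
    using t by blast
qed

text \<open>Since \<open>fc m\<close> is the mean of the \<open>\<rho>c m s\<close>, the partial
  sums return to 0 after a full turn. This is the solvability condition of the cyclic difference
  equation in \<open>tc_step\<close>.\<close>

lemma tc_last: "tc (Suc m) (n - 1) x = 0"
proof -
  have "{..n - 1} = {..<n}"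
    using n0 by auto
  then show ?thesis
    using n0 by (simp add: tc.simps(2) sum_subtractf fc.simps)
qed

lemma tc_step:
  assumes "r < n"
  shows "tc (Suc m) r x - tc (Suc m) (if r = 0 then n - 1 else r - 1) x = \<rho>c m r x - fc m x"
proof (cases r)
  case 0
  then show ?thesis using tc_last[of m x] by (simp add: tc.simps(2))
qed (simp add: tc.simps(2))

text \<open>This is the series with terms diag(\<open>tc m 0\<close>, ...,
  \<open>tc m (n - 1)\<close>) J^(-m), whose leading term is the identity.\<close>

definition gaugeT :: "real \<Rightarrow> real fls mat" where
  "gaugeT x = of_band n (\<lambda>r c. if c < r then 0 else tc (nat (c - r)) (nat (r mod int n)) x)"

lemma band_gaugeT:
  "band n (gaugeT x) r c = (if c < r then 0 else tc (nat (c - r)) (nat (r mod int n)) x)"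
  unfolding gaugeT_def by (rule band_of_band[OF n0, where d = 0]) auto

lemma smooth_band_gaugeT: "smooth_band n 0 gaugeT"
proof -
  have "gaugeT x \<in> carrier_mat n n" for x
    by (simp add: gaugeT_def)
  then show ?thesis
    using n0 smooth_coeffs by (auto simp: smooth_band_def band_le_def band_gaugeT nat_mod_less intro!: smooth_if)
qed

definition gaugeF :: "real \<Rightarrow> real fls mat" where
  "gaugeF x = of_band n (\<lambda>r c. if c < r then 0 else fc (nat (c - r)) x)"

lemma band_gaugeF: "band n (gaugeF x) r c = (if c < r then 0 else fc (nat (c - r)) x)"
  unfolding gaugeF_def by (rule band_of_band[OF n0, where d = 0]) auto

lemma gaugeF_carrier [simp, intro]: "gaugeF x \<in> carrier_mat n n"
  by (simp add: gaugeF_def)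

lemma band_le_gaugeF: "band_le n (gaugeF x) 0"
  by (simp add: band_le_def band_gaugeF)

lemma gaugeT_carrier [simp, intro]: "gaugeT x \<in> carrier_mat n n"
  by (simp add: gaugeT_def)

lemma gaugeT_dim [simp]: "dim_row (gaugeT x) = n" "dim_col (gaugeT x) = n"
  by (simp_all add: gaugeT_def of_band_def)

lemma band_le_gaugeT: "band_le n (gaugeT x) 0"
  by (simp add: band_le_def band_gaugeT)

text \<open>Entries of \<open>gaugeF\<close> depend only on \<open>c - r\<close>, so a shift of rows
  equals a shift of columns.\<close>

lemma J_gaugeF_commute: "J_mat n * gaugeF x = gaugeF x * J_mat n"
  by (rule band_eqI)
     (auto simp: band_J_mult[OF _ band_le_gaugeF] band_mult_J[OF _ band_le_gaugeF] band_gaugeF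
       algebra_simps)

lemma nat_pred_mod:
  "nat ((r - 1) mod int n) = (if nat (r mod int n) = 0 then n - 1 else nat (r mod int n) - 1)"
proof -
  define q where "q = r div int n"
  define s where "s = r mod int n"
  have r: "r = s + q * int n" and s: "0 \<le> s" "s < int n"
    using n0 by (auto simp: q_def s_def)
  have "(r - 1) mod int n = (s - 1) mod int n"
    unfolding s_def by (simp add: mod_diff_left_eq)
  also have "\<dots> = (if s = 0 then int n - 1 else s - 1)"
  proof (cases "s = 0")
    case True
    have "(s - 1) mod int n = (int n - 1) mod int n"
      using True by simp
    also have "\<dots> = int n - 1"
      using n0 by (intro mod_pos_pos_trivial) auto
    finally show ?thesis using True by simp
  qed (use s in auto)
  finally show ?thesis
    using s n0 unfolding s_def[symmetric] by (auto simp: nat_diff_distrib)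
qed

lemma gauge_equation:
  "band_deriv n gaugeT x + conn x * gaugeT x = gaugeT x * (J_mat n + gaugeF x)"
proof (rule band_eqI)
  fix r c
  note [simp] = band_gaugeT band_gaugeF
  have F: "band n (gaugeT x * gaugeF x) r c
      = (\<Sum>s\<in>{r..c}. band n (gaugeT x) r s * band n (gaugeF x) s c)"
    by (subst band_mult[OF n0 gaugeT_carrier gaugeF_carrier band_le_gaugeT band_le_gaugeF]) simp
  have lhs: "band n (band_deriv n gaugeT x + conn x * gaugeT x) r c
      = deriv (\<lambda>y. band n (gaugeT y) r c) x
        + (band n (gaugeT x) (r - 1) c + U r x * band n (gaugeT x) (last_col r) c)"
    by (simp add: band_add n0 band_band_deriv[OF n0 smooth_band_gaugeT]
        band_conn_mult[OF gaugeT_carrier band_le_gaugeT] del: band_gaugeT)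
  have "gaugeT x * (J_mat n + gaugeF x) = gaugeT x * J_mat n + gaugeT x * gaugeF x"
    by (rule mult_add_distrib_mat[where n = n and nr = n and nc = n]) auto
  then have rhs: "band n (gaugeT x * (J_mat n + gaugeF x)) r c
      = band n (gaugeT x) r (c + 1) + band n (gaugeT x * gaugeF x) r c"
    by (simp add: band_add n0 band_mult_J[OF gaugeT_carrier band_le_gaugeT] del: band_gaugeT)
  consider "c < r - 1" | "c = r - 1" | "c \<ge> r" by linarith
  then show "band n (band_deriv n gaugeT x + conn x * gaugeT x) r c
      = band n (gaugeT x * (J_mat n + gaugeF x)) r c"
  proof cases
    case 3
    define m s where "m = nat (c - r)" and "s = nat (r mod int n)"
    have c: "c = r + int m" and s: "s < n"
      using 3 n0 by (auto simp: m_def s_def nat_mod_less)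
    have "r = r div int n * int n + int s"
      using n0 by (simp add: s_def)
    then have "last_col r - r = int (n - 1 - s)"
      using s unfolding last_col_def by linarith
    then have lc: "last_col r = r + int (n - 1 - s)"
      by simp
    have lmod: "nat (last_col r mod int n) = n - 1"
      using eq_last_col_iff[of "last_col r" r] n0 by simp
    \<comment> \<open>Passing from row \<open>r\<close> to row \<open>last_col r\<close> moves by
      \<open>n - 1 - s\<close>. If \<open>c\<close> lies left of that, \<open>gaugeT\<close>
      vanishes; the \<open>if\<close> guards the truncated subtraction accordingly.\<close>
    have U: "U r x * band n (gaugeT x) (last_col r) c
        = (if n - 1 - s \<le> m then u x $$ (s, n - 1) * tc (m - (n - 1 - s)) (n - 1) x else 0)"
    proof -
      have "nat (c - last_col r) = m - (n - 1 - s)" "c < last_col r \<longleftrightarrow> \<not> n - 1 - s \<le> m"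
        using lc c by linarith+
      then show ?thesis
        using lmod by (simp add: U_def s_def[symmetric])
    qed
    \<comment> \<open>Positions \<open>(r - 1, c)\<close> and \<open>(r, c + 1)\<close> both lie at
      distance \<open>m + 1\<close> from the diagonal; they supply the two unknowns of the
      difference equation.\<close>
    have T1: "band n (gaugeT x) (r - 1) c = tc (Suc m) (if s = 0 then n - 1 else s - 1) x"
      using c by (simp add: nat_pred_mod s_def nat_add_distrib)
    have T2: "band n (gaugeT x) r (c + 1) = tc (Suc m) s x"
      using c by (simp add: s_def nat_add_distrib)
    have "band n (gaugeT x * gaugeF x) r c = (\<Sum>k\<le>m. tc k s x * fc (m - k) x)"
    proof -
      have "nat (int m - int k) = m - k" for k
        by linarith
      then show ?thesis
        unfolding F using 3 by (subst sum_int_interval) (auto simp: c s_def intro!: sum.cong)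
    qed
    \<comment> \<open>Reversed, the convolution has the form used in \<open>\<rho>c\<close>; its
      last term is \<open>fc m x\<close> because \<open>tc 0\<close> is 1.\<close>
    also have "\<dots> = (\<Sum>k\<le>m. fc k x * tc (m - k) s x)"
      by (rule sum.reindex_bij_witness[where i = "\<lambda>k. m - k" and j = "\<lambda>k. m - k"]) auto
    also have "\<dots> = (\<Sum>k<m. fc k x * tc (m - k) s x) + fc m x"
      by (simp add: lessThan_Suc_atMost[symmetric])
    finally have F': "band n (gaugeT x * gaugeF x) r c
        = (\<Sum>k<m. fc k x * tc (m - k) s x) + fc m x" .
    have D: "deriv (\<lambda>y. band n (gaugeT y) r c) x = deriv (tc m s) x"
      using c by (simp add: s_def)
    show ?thesis
      unfolding lhs rhs U T1 T2 F' D using tc_step[OF s, of m x] by (simp add: \<rho>c.simps)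
  next
    case 1
    then show ?thesis
      unfolding lhs rhs F using last_col_ge[of r] by simp
  next
    case 2
    then show ?thesis
      unfolding lhs rhs F using last_col_ge[of r] by simp
  qed
qed auto

end

section \<open>The inverse gauge transformation and the existence of Y\<close>

lemma eq_minus_of_add_eq:
  fixes X :: "'a::ab_group_add mat"
  assumes "X \<in> carrier_mat n n" "Y \<in> carrier_mat n n" "X + Y = Z"
  shows "X = Z - Y"
  using assms by (intro eq_matI) auto

lemma minus_minus_zero_mat:
  fixes X Y :: "'a::ab_group_add mat"
  assumes "X \<in> carrier_mat n n" "Y \<in> carrier_mat n n"
  shows "0\<^sub>m n n - (X - Y) = Y - X"
  using assms by (intro eq_matI) auto

definition mat_trace :: "nat \<Rightarrow> 'a::comm_ring_1 mat \<Rightarrow> 'a" where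
  "mat_trace n A = (\<Sum>r<n. A $$ (r, r))"

lemma mat_trace_mult_commute:
  assumes "A \<in> carrier_mat n n" "B \<in> carrier_mat n n"
  shows "mat_trace n (A * B) = mat_trace n (B * A)"
proof -
  have "mat_trace n (A * B) = (\<Sum>r<n. \<Sum>s<n. A $$ (r, s) * B $$ (s, r))"
    using assms by (simp add: mat_trace_def mult_mat_sum[of _ n] del: index_mult_mat)
  also have "\<dots> = (\<Sum>s<n. \<Sum>r<n. B $$ (s, r) * A $$ (r, s))"
    by (subst sum.swap) (simp add: mult.commute)
  also have "\<dots> = mat_trace n (B * A)"
    using assms by (simp add: mat_trace_def mult_mat_sum[of _ n] del: index_mult_mat)
  finally show ?thesis .
qed

context kdv_potential
begin

text \<open>Coefficients of the inverse series S. As \<open>tc 0\<close> is 1, the equation T S = 1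
  expresses \<open>sc (Suc m)\<close> by earlier ones; a term of T at distance \<open>Suc i\<close>
  from the diagonal meets row \<open>r + Suc i\<close> of S, hence the residue.\<close>

fun sc :: "nat \<Rightarrow> nat \<Rightarrow> real \<Rightarrow> real" where
  "sc 0 r = (\<lambda>x. 1)"
| "sc (Suc m) r = (\<lambda>x. - (\<Sum>i\<in>{..m}. tc (Suc i) r x * sc (m - i) ((r + Suc i) mod n) x))"

declare sc.simps(2) [simp del]

lemma smooth_sc: "r < n \<Longrightarrow> smooth (sc m r)"
proof (induction m arbitrary: r rule: less_induct)
  case (less m)
  then show ?case
    using smooth_coeffs n0
    by (cases m) (auto simp: sc.simps(2) intro!: smooth_uminus smooth_sum smooth_mult less.IH)
qed

definition gaugeS :: "real \<Rightarrow> real fls mat" where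
  "gaugeS x = of_band n (\<lambda>r c. if c < r then 0 else sc (nat (c - r)) (nat (r mod int n)) x)"

lemma band_gaugeS:
  "band n (gaugeS x) r c = (if c < r then 0 else sc (nat (c - r)) (nat (r mod int n)) x)"
  unfolding gaugeS_def by (rule band_of_band[OF n0, where d = 0]) auto

lemma gaugeS_carrier [simp, intro]: "gaugeS x \<in> carrier_mat n n"
  by (simp add: gaugeS_def)

lemma gaugeS_dim [simp]: "dim_row (gaugeS x) = n" "dim_col (gaugeS x) = n"
  by (simp_all add: gaugeS_def of_band_def)

lemma band_le_gaugeS: "band_le n (gaugeS x) 0"
  by (simp add: band_le_def band_gaugeS)

lemma smooth_band_gaugeS: "smooth_band n 0 gaugeS"
  using n0 band_le_gaugeS
  by (auto simp: smooth_band_def band_gaugeS nat_mod_less intro!: smooth_if smooth_sc)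

lemma gaugeT_gaugeS: "gaugeT x * gaugeS x = 1\<^sub>m n"
proof (rule band_eqI)
  fix r c
  have *: "band n (gaugeT x * gaugeS x) r c
      = (\<Sum>s\<in>{r..c}. band n (gaugeT x) r s * band n (gaugeS x) s c)"
    by (subst band_mult[OF n0 gaugeT_carrier gaugeS_carrier band_le_gaugeT band_le_gaugeS]) simp
  have diag: "band n (gaugeT x * gaugeS x) r r = 1"
    by (subst band_mult[OF n0 gaugeT_carrier gaugeS_carrier band_le_gaugeT band_le_gaugeS])
       (simp add: band_gaugeT band_gaugeS)
  consider "c < r" | "c = r" | "c > r" by linarith
  then show "band n (gaugeT x * gaugeS x) r c = band n (1\<^sub>m n) r c"
  proof cases
    case 3
    define m s where "m = nat (c - r) - 1" and "s = nat (r mod int n)"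
    have c: "c = r + int (Suc m)"
      using 3 by (simp add: m_def)
    have mod: "nat ((r + int i) mod int n) = (s + i) mod n" for i
    proof -
      have "(r + int i) mod int n = (int s + int i) mod int n"
        using n0 by (simp add: s_def mod_add_left_eq)
      then show ?thesis
        by (simp flip: of_nat_add zmod_int)
    qed
    have "band n (gaugeT x * gaugeS x) r c
        = (\<Sum>k\<le>Suc m. tc k s x * sc (Suc m - k) ((s + k) mod n) x)"
    proof -
      have "band n (gaugeT x * gaugeS x) r c
          = (\<Sum>k\<le>nat (c - r). band n (gaugeT x) r (r + int k) * band n (gaugeS x) (r + int k) c)"
        unfolding * using 3 by (intro sum_int_interval) simp
      also have "nat (c - r) = Suc m"
        using c by simp
      also have "(\<Sum>k\<le>Suc m. band n (gaugeT x) r (r + int k) * band n (gaugeS x) (r + int k) c)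
          = (\<Sum>k\<le>Suc m. tc k s x * sc (Suc m - k) ((s + k) mod n) x)"
      proof (rule sum.cong[OF refl])
        fix k assume "k \<in> {..Suc m}"
        then have "nat (c - (r + int k)) = Suc m - k" "\<not> c < r + int k"
          using c by auto
        then show "band n (gaugeT x) r (r + int k) * band n (gaugeS x) (r + int k) c
            = tc k s x * sc (Suc m - k) ((s + k) mod n) x"
          using mod[of k] by (simp add: band_gaugeT band_gaugeS s_def[symmetric])
      qed
      finally show ?thesis .
    qed
    also have "\<dots> = sc (Suc m) (s mod n) x
        + (\<Sum>k\<le>m. tc (Suc k) s x * sc (m - k) ((s + Suc k) mod n) x)"
      by (subst sum.atMost_Suc_shift) simp
    also have "s mod n = s"
      using n0 by (simp add: s_def nat_mod_less)
    finally show ?thesis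
      using 3 n0 by (simp add: sc.simps(2) band_one)
  qed (use diag in \<open>auto simp: * band_one n0 band_gaugeT band_gaugeS\<close>)
qed auto

text \<open>For square matrices over the field of Laurent series a right inverse is also a left
  inverse.\<close>

lemma gaugeS_gaugeT: "gaugeS x * gaugeT x = 1\<^sub>m n"
  by (rule mat_mult_left_right_inverse[OF gaugeT_carrier gaugeS_carrier gaugeT_gaugeS])

text \<open>Conjugation by T turns the connection J + u into J + f. A constant \<open>M\<close>
  commuting with J + f is parallel for the latter, so T M S is parallel for the former.\<close>

lemma dressing:
  assumes M: "M \<in> carrier_mat n n" "band_le n M d"
    and comm: "M * (J_mat n + gaugeF x) = (J_mat n + gaugeF x) * M"
  shows "band_deriv n (\<lambda>y. gaugeT y * M * gaugeS y) x
    + commutator (conn x) (gaugeT x * M * gaugeS x) = 0\<^sub>m n n"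
proof -
  define T S A G where "T = gaugeT x" and "S = gaugeS x" and "A = conn x"
    and "G = J_mat n + gaugeF x"
  define T' S' where "T' = band_deriv n gaugeT x" and "S' = band_deriv n gaugeS x"
  have car [simp]: "T \<in> carrier_mat n n" "S \<in> carrier_mat n n" "A \<in> carrier_mat n n"
    "G \<in> carrier_mat n n" "T' \<in> carrier_mat n n" "S' \<in> carrier_mat n n" "M \<in> carrier_mat n n"
    using M by (auto simp: T_def S_def A_def G_def T'_def S'_def)
  note assoc = assoc_mult_mat[where ?n\<^sub>1.0 = n and ?n\<^sub>2.0 = n and ?n\<^sub>3.0 = n and ?n\<^sub>4.0 = n]
  note distr = mult_minus_distrib_mat[where n = n and nr = n and nc = n]
    minus_mult_distrib_mat[where n = n and nr = n and nc = n]
  have TS: "T * S = 1\<^sub>m n" "S * T = 1\<^sub>m n"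
    by (simp_all add: T_def S_def gaugeT_gaugeS gaugeS_gaugeT)
  have TSX: "T * (S * X) = X" "S * (T * X) = X" if "X \<in> carrier_mat n n" for X
    using that TS by (simp_all add: assoc[symmetric])
  have T': "T' = T * G - A * T"
    using gauge_equation[of x] unfolding T_def A_def G_def T'_def
    by (intro eq_minus_of_add_eq[where n = n]) auto
  \<comment> \<open>The derivative of S is obtained by differentiating T S = 1.\<close>
  have "T' * S + T * S' = band_deriv n (\<lambda>x. gaugeT x * gaugeS x) x"
    unfolding T_def S_def T'_def S'_def
    by (rule band_deriv_mult[OF n0 smooth_band_gaugeT smooth_band_gaugeS, symmetric])
  also have "\<dots> = 0\<^sub>m n n"
    unfolding gaugeT_gaugeS
    by (rule band_deriv_const[OF n0, where d = 0]) (auto simp: band_le_def band_one n0)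
  finally have "T * S' + T' * S = 0\<^sub>m n n"
    by (simp add: comm_add_mat[where nr = n and nc = n])
  then have "T * S' = 0\<^sub>m n n - T' * S"
    by (intro eq_minus_of_add_eq[where n = n]) auto
  then have "S * (T * S') = S * (0\<^sub>m n n - T' * S)"
    by simp
  then have "S' = S * (0\<^sub>m n n) - S * (T' * S)"
    by (simp add: TSX distr)
  also have "S * (T' * S) = G * S - S * A"
    unfolding T' by (simp add: distr assoc TSX TS right_mult_one_mat[where nr = n])
  also have "S * 0\<^sub>m n n = 0\<^sub>m n n"
    by (rule right_mult_zero_mat) simp
  finally have S': "S' = S * A - G * S"
    using minus_minus_zero_mat[of "G * S" n "S * A"] by simp
  have "band_deriv n (\<lambda>y. gaugeT y * M * gaugeS y) x
      = band_deriv n (\<lambda>y. gaugeT y * M) x * S + T * M * S'"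
    unfolding T_def S_def S'_def
    by (rule band_deriv_mult[OF n0 smooth_band_mult[OF n0 smooth_band_gaugeT smooth_band_const[OF M]]
          smooth_band_gaugeS])
  also have "band_deriv n (\<lambda>y. gaugeT y * M) x = T' * M + T * 0\<^sub>m n n"
    unfolding T_def T'_def
    using band_deriv_mult[OF n0 smooth_band_gaugeT smooth_band_const[OF M], of x]
      band_deriv_const[OF n0 M, of x] by simp
  also have "\<dots> = T' * M"
    using right_mult_zero_mat[of T n n n] right_add_zero_mat[of "T' * M" n n] by simp
  finally have "band_deriv n (\<lambda>y. gaugeT y * M * gaugeS y) x = T' * M * S + T * M * S'" .
  also have "T' * M * S = T * (G * (M * S)) - A * (T * (M * S))"
    unfolding T' by (simp add: distr assoc)
  also have "T * M * S' = T * (M * (S * A)) - T * (M * (G * S))"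
    unfolding S' by (simp add: distr assoc)
  also have "M * (G * S) = G * (M * S)"
    using comm[folded G_def] by (simp add: assoc[symmetric])
  finally have "band_deriv n (\<lambda>y. gaugeT y * M * gaugeS y) x
    = (T * (G * (M * S)) - A * (T * (M * S))) + (T * (M * (S * A)) - T * (G * (M * S)))" .
  moreover have "commutator A (T * M * S) = A * (T * (M * S)) - T * (M * (S * A))"
    by (simp add: commutator_def assoc)
  moreover have "(P - Q) + (R - P) + (Q - R) = 0\<^sub>m n n"
    if "P \<in> carrier_mat n n" "Q \<in> carrier_mat n n" "R \<in> carrier_mat n n" for P Q R :: "real fls mat"
    using that by (auto intro!: eq_matI)
  ultimately show ?thesis
    unfolding A_def[symmetric] T_def[symmetric] S_def[symmetric] by simp
qed

lemma J_pow_commute: "J_mat n ^\<^sub>m k * (J_mat n + gaugeF x) = (J_mat n + gaugeF x) * J_mat n ^\<^sub>m k"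
proof (induction k)
  case (Suc k)
  note assoc = assoc_mult_mat[where ?n\<^sub>1.0 = n and ?n\<^sub>2.0 = n and ?n\<^sub>3.0 = n and ?n\<^sub>4.0 = n]
  let ?G = "J_mat n + gaugeF x"
  have G: "?G \<in> carrier_mat n n"
    by auto
  have JG: "J_mat n * ?G = ?G * J_mat n"
    using J_gaugeF_commute[of x]
    by (simp add: mult_add_distrib_mat[where n = n and nr = n and nc = n]
        add_mult_distrib_mat[where n = n and nr = n and nc = n])
  have "J_mat n ^\<^sub>m Suc k * ?G = J_mat n ^\<^sub>m k * ?G * J_mat n"
    using G JG by (simp add: assoc)
  also have "\<dots> = ?G * J_mat n ^\<^sub>m Suc k"
    unfolding Suc using G by (simp add: assoc)
  finally show ?case .
next
  case 0
  have "J_mat n + gaugeF x \<in> carrier_mat n n"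
    by auto
  then show ?case
    by (simp add: left_mult_one_mat[where nr = n and nc = n] right_mult_one_mat[where nr = n and nc = n])
qed

lemma band_J_pow: "band n (J_mat n ^\<^sub>m k) r c = (if c = r - int k then 1 else 0)
    \<and> band_le n (J_mat n ^\<^sub>m k) (int k)"
proof (induction k arbitrary: r c)
  case 0
  then show ?case using n0 by (auto simp: band_le_def band_one)
next
  case (Suc k)
  then have le: "band_le n (J_mat n ^\<^sub>m k) (int k)" by blast
  have "band n (J_mat n ^\<^sub>m Suc k) r c = (if c = r - int (Suc k) then 1 else 0)" for r c
    using Suc band_mult_J[OF pow_mat_carrier[OF J_mat_carrier] le, of r c] by auto
  then show ?case
    by (simp add: band_le_def)
qed

definition Ysol :: "real \<Rightarrow> real fls mat" where
  "Ysol x = gaugeT x * J_mat n * gaugeS x"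

lemma Ysol_pow: "Ysol x ^\<^sub>m k = gaugeT x * J_mat n ^\<^sub>m k * gaugeS x"
proof (induction k)
  case 0
  then show ?case
    by (simp add: Ysol_def gaugeT_gaugeS)
next
  case (Suc k)
  note assoc = assoc_mult_mat[where ?n\<^sub>1.0 = n and ?n\<^sub>2.0 = n and ?n\<^sub>3.0 = n and ?n\<^sub>4.0 = n]
  have "gaugeS x * (gaugeT x * X) = X" if "X \<in> carrier_mat n n" for X
    using that by (simp add: assoc[symmetric] gaugeS_gaugeT)
  then show ?case
    using Suc by (simp add: Ysol_def assoc)
qed

lemma Ysol_pow_smooth_band: "smooth_band n (int k) (\<lambda>x. Ysol x ^\<^sub>m k)"
  using smooth_band_mult[OF n0 smooth_band_mult[OF n0 smooth_band_gaugeT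
        smooth_band_const[OF pow_mat_carrier[OF J_mat_carrier] conjunct2[OF band_J_pow]]] smooth_band_gaugeS]
  by (simp add: Ysol_pow)

lemma Ysol_pow_eq: "band_deriv n (\<lambda>y. Ysol y ^\<^sub>m k) x + commutator (conn x) (Ysol x ^\<^sub>m k) = 0\<^sub>m n n"
  unfolding Ysol_pow
  by (rule dressing[OF pow_mat_carrier[OF J_mat_carrier] conjunct2[OF band_J_pow] J_pow_commute])

lemma is_Y_Ysol: "is_Y n u Ysol"
proof -
  have car: "Ysol x \<in> carrier_mat n n" for x
    by (auto simp: Ysol_def)
  have pow1: "A ^\<^sub>m 1 = A" if "A \<in> carrier_mat n n" for A :: "real fls mat"
    using that by simp
  have sb: "smooth_band n 1 Ysol"
    using Ysol_pow_smooth_band[of 1] unfolding pow1[OF car] by simp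
  have eq: "band_deriv n Ysol x + commutator (conn x) (Ysol x) = 0\<^sub>m n n" for x
    using Ysol_pow_eq[of 1 x] unfolding pow1[OF car] .
  have top: "band n (Ysol x) 0 (- 1) = 1" for x
  proof -
    have 1: "band_le n (J_mat n) 1"
      using n2 by (auto simp: band_le_def band_J_mat)
    then have 2: "band_le n (gaugeT x * J_mat n) (0 + 1)"
      by (intro band_le_mult n0 band_le_gaugeT) auto
    have "band n (Ysol x) 0 (- 1) = band n (gaugeT x * J_mat n) 0 (0 - (0 + 1)) * band n (gaugeS x) (0 - (0 + 1)) (- 1)"
      unfolding Ysol_def by (rule band_mult_top[OF n0 _ _ 2 band_le_gaugeS]) auto
    then show ?thesis
      by (simp add: band_mult_J[OF _ band_le_gaugeT] band_gaugeT band_gaugeS)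
  qed
  have low: "band n (Ysol x) r c = 0" if "c < r - 1" for x r c
    using sb that by (simp add: smooth_band_def band_le_def)
  \<comment> \<open>Taken over Laurent series, the trace is invariant under conjugation, and J has
    zero diagonal because \<open>2 \<le> n\<close>.\<close>
  have tr: "mat_trace n (Ysol x) = 0" for x
  proof -
    note assoc = assoc_mult_mat[where ?n\<^sub>1.0 = n and ?n\<^sub>2.0 = n and ?n\<^sub>3.0 = n and ?n\<^sub>4.0 = n]
    have "mat_trace n (Ysol x) = mat_trace n (gaugeT x * (J_mat n * gaugeS x))"
      by (simp add: Ysol_def assoc)
    also have "\<dots> = mat_trace n (J_mat n * gaugeS x * gaugeT x)"
      by (rule mat_trace_mult_commute) auto
    also have "J_mat n * gaugeS x * gaugeT x = J_mat n"
      by (simp add: assoc gaugeS_gaugeT right_mult_one_mat[OF J_mat_carrier])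
    also have "mat_trace n (J_mat n) = 0"
      unfolding mat_trace_def using n2 by (intro sum.neutral) (auto simp: J_mat_def e1n_mat_def b_mat_def)
    finally show ?thesis .
  qed
  show ?thesis
    unfolding is_Y_def
  proof (fold conn_def, intro conjI allI impI)
    show "Ysol x \<in> carrier_mat n n" for x
      by (rule car)
    show "smooth_mat n (\<lambda>x. lam_coeff i (Ysol x))" for i
      using car sb by (auto simp: smooth_mat_def lam_coeff_index[where n = n] smooth_band_def)
    show "(\<Sum>r<n. lam_coeff i (Ysol x) $$ (r, r)) = 0" for i x
    proof -
      have "(\<Sum>r<n. lam_coeff i (Ysol x) $$ (r, r)) = fls_nth (mat_trace n (Ysol x)) (- i)"
        using car[of x] by (simp add: mat_trace_def fls_nth_sum lam_coeff_def)
      then show ?thesis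
        by (simp add: tr)
    qed
    show "lam_coeff i (Ysol x) = 0\<^sub>m n n" if "1 < i" for i x
    proof (rule eq_matI)
      fix r c assume "r < dim_row (0\<^sub>m n n :: real mat)" "c < dim_col (0\<^sub>m n n :: real mat)"
      then have rc: "r < n" "c < n" by auto
      \<comment> \<open>From \<lambda>^2 on, every entry has degree at least \<open>n + 1\<close>,
        above the bound 1.\<close>
      have "2 * int n \<le> i * int n"
        using that by (intro mult_right_mono) auto
      then have "int c - i * int n < int r - 1"
        using rc by linarith
      then show "lam_coeff i (Ysol x) $$ (r, c) = 0\<^sub>m n n $$ (r, c)"
        using rc car[of x] low by (simp add: lam_coeff_index[where n = n])
    qed (use car in \<open>auto simp: lam_coeff_def\<close>)
    show "lam_coeff 1 (Ysol x) = e1n_mat n" for x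
    proof (rule eq_matI)
      fix r c assume "r < dim_row (e1n_mat n)" "c < dim_col (e1n_mat n)"
      then have rc: "r < n" "c < n" by (auto simp: e1n_mat_def)
      show "lam_coeff 1 (Ysol x) $$ (r, c) = e1n_mat n $$ (r, c)"
      proof (cases "r = 0 \<and> c = n - 1")
        case True
        then show ?thesis
          using n0 car[of x] top[of x] by (simp add: lam_coeff_index[where n = n] e1n_mat_def of_nat_diff)
      next
        case False
        \<comment> \<open>In the coefficient of \<lambda> the degree r - c + n exceeds 1 everywhere
          except in the upper right corner.\<close>
        then have "int c - int n < int r - 1"
          using rc by linarith
        then show ?thesis
          using rc False car[of x] low by (auto simp: lam_coeff_index[where n = n] e1n_mat_def)
      qed
    qed (use car in \<open>auto simp: lam_coeff_def e1n_mat_def\<close>)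
    show "mat_deriv n (\<lambda>y. lam_coeff i (Ysol y)) x + lam_coeff i (commutator (conn x) (Ysol x)) = 0\<^sub>m n n" for i x
    proof -
      have "mat_deriv n (\<lambda>y. lam_coeff i (Ysol y)) x + lam_coeff i (commutator (conn x) (Ysol x))
          = lam_coeff i (band_deriv n Ysol x + commutator (conn x) (Ysol x))"
        using car by (simp add: mat_deriv_lam_coeff[OF n0 sb] lam_coeff_add[where n = n])
      also have "\<dots> = 0\<^sub>m n n"
        unfolding eq by (auto intro!: eq_matI simp: lam_coeff_def)
      finally show ?thesis .
    qed
    show "Ysol x ^\<^sub>m n = fls_X_inv \<cdot>\<^sub>m 1\<^sub>m n" for x
    proof -
      have "J_mat n ^\<^sub>m n = fls_X_inv \<cdot>\<^sub>m 1\<^sub>m n"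
        by (rule band_eqI[where n = n]) (auto simp: band_J_pow band_smult_X_inv_one[OF n0])
      then have "Ysol x ^\<^sub>m n = gaugeT x * (fls_X_inv \<cdot>\<^sub>m 1\<^sub>m n) * gaugeS x"
        by (simp add: Ysol_pow)
      also have "\<dots> = fls_X_inv \<cdot>\<^sub>m (gaugeT x * gaugeS x)"
        using gaugeT_carrier[of x] gaugeS_carrier[of x]
        by (simp add: mult_smult_distrib[where nr = n and n = n and nc = n]
            mult_smult_assoc_mat[where nr = n and n = n and nc = n] right_mult_one_mat[OF gaugeT_carrier])
      finally show ?thesis
        by (simp add: gaugeT_gaugeS)
    qed
  qed
qed

lemma Y_series_eq: "Y_series n u = Ysol"
  unfolding Y_series_def
  by (rule the_equality[where P = "is_Y n u"]) (auto intro: is_Y_Ysol is_Y_unique)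

end

section \<open>The matrices \<open>\<zeta>\<close> and \<open>Z\<close>\<close>

lemma mat_deriv_shift: "mat_deriv n (\<lambda>y. F (y + a)) x = mat_deriv n F (x + a)"
proof -
  have "deriv (\<lambda>y. F (y + a) $$ (r, c)) x = deriv (\<lambda>y. F y $$ (r, c)) (x + a)" for r c
    using deriv_shift[of "\<lambda>y. F y $$ (r, c)" a x] .
  then show ?thesis
    by (simp add: mat_deriv_def)
qed

lemma smooth_mat_shift: "smooth_mat n F \<Longrightarrow> smooth_mat n (\<lambda>x. F (x + a))"
  using smooth_shift[of "\<lambda>x. F x $$ (r, c)" a for r c] by (auto simp: smooth_mat_def)

text \<open>The conditions depend on \<open>x\<close> only through \<open>u\<close>, so a period of
  \<open>u\<close> acts on the set of solutions by translation.\<close>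

lemma is_Y_shift:
  assumes "is_Y n u Y" "\<And>x. u (x + a) = u x"
  shows "is_Y n u (\<lambda>x. Y (x + a))"
proof -
  have "mat_deriv n (\<lambda>y. lam_coeff i (Y (y + a))) x = mat_deriv n (\<lambda>y. lam_coeff i (Y y)) (x + a)" for i x
    using mat_deriv_shift[of n "\<lambda>y. lam_coeff i (Y y)" a x] .
  moreover have "mat_deriv n (\<lambda>y. lam_coeff i (Y y)) (x + a)
      + lam_coeff i (commutator (J_mat n + map_mat fls_const (u x)) (Y (x + a))) = 0\<^sub>m n n" for i x
    using assms unfolding is_Y_def by metis
  moreover have "smooth_mat n (\<lambda>x. lam_coeff i (Y (x + a)))" for i
    using smooth_mat_shift[of n "\<lambda>x. lam_coeff i (Y x)"] assms by (simp add: is_Y_def)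
  ultimately show ?thesis
    using assms(1) by (simp add: is_Y_def)
qed

lemma b_mat_carrier [simp, intro]: "b_mat n \<in> carrier_mat n n"
  by (simp add: b_mat_def)

lemma in_V_spaceI:
  assumes "M \<in> carrier_mat n n" "\<And>r c. r < n \<Longrightarrow> c < n - 1 \<Longrightarrow> M $$ (r, c) = 0"
    and "M $$ (n - 1, n - 1) = 0"
  shows "M \<in> V_space n"
proof -
  have "M $$ (r, c) = u_mat n (\<lambda>i. M $$ (i - 1, n - 1)) $$ (r, c)" if rc: "r < n" "c < n" for r c
  proof -
    consider "c < n - 1" | "c = n - 1" "r < n - 1" | "c = n - 1" "r = n - 1"
      using rc by linarith
    then show ?thesis
      using rc assms by cases (auto simp: u_mat_def)
  qed
  then have "M = u_mat n (\<lambda>i. M $$ (i - 1, n - 1))"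
    using assms(1) by (intro eq_matI) (auto simp: u_mat_def)
  then show ?thesis
    unfolding V_space_def by blast
qed

context kdv_potential
begin

lemma b_u_dim [simp]: "dim_row (b_mat n) = n" "dim_col (b_mat n) = n"
    "dim_row (u x) = n" "dim_col (u x) = n"
  using u_carrier[of x] by (auto simp: b_mat_def simp del: u_carrier)

text \<open>In a column \<open>c < n - 1\<close>, right multiplication by \<open>u\<close>
  contributes nothing and \<open>b\<close> only brings in column \<open>Suc c\<close>. Vanishing of
  the bracket thus expresses each column of \<open>B\<close> by the preceding one.\<close>

lemma conn_bracket_index:
  assumes B: "\<And>x. B x \<in> carrier_mat n n" and rc: "r < n" "c < n - 1"
  shows "conn_bracket n (\<lambda>y. b_mat n + u y) B x $$ (r, c) =
    deriv (\<lambda>y. B y $$ (r, c)) x + (if r = 0 then 0 else B x $$ (r - 1, c))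
      + u x $$ (r, n - 1) * B x $$ (n - 1, c) - B x $$ (r, Suc c)"
proof -
  have "((b_mat n + u x) * B x) $$ (r, c)
      = (\<Sum>s<n. (if s = r - 1 then if r = 0 then 0 else B x $$ (s, c) else 0)
        + (if s = n - 1 then u x $$ (r, n - 1) * B x $$ (s, c) else 0))"
    using B[of x] rc u_carrier[of x]
    by (subst mult_mat_sum[of _ n])
       (auto simp: b_mat_def distrib_right u_index intro!: sum.cong)
  also have "\<dots> = (if r = 0 then 0 else B x $$ (r - 1, c)) + u x $$ (r, n - 1) * B x $$ (n - 1, c)"
    unfolding sum.distrib using rc by (subst (1 2) sum.delta) auto
  finally have AB: "((b_mat n + u x) * B x) $$ (r, c) = \<dots>" .
  have "(B x * (b_mat n + u x)) $$ (r, c) = (\<Sum>s<n. if s = Suc c then B x $$ (r, s) else 0)"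
    using B[of x] rc u_carrier[of x]
    by (subst mult_mat_sum[of _ n])
       (auto simp: b_mat_def distrib_left u_index simp del: sum.delta sum.delta' intro!: sum.cong)
  also have "\<dots> = B x $$ (r, Suc c)"
    using rc by (subst sum.delta) auto
  finally have BA: "(B x * (b_mat n + u x)) $$ (r, c) = B x $$ (r, Suc c)" .
  show ?thesis
    using AB BA rc B[of x] u_carrier[of x]
    by (simp add: conn_bracket_def commutator_def mat_deriv_def del: index_mult_mat(1))
qed

lemma conn_bracket_carrier [simp, intro]:
  assumes "\<And>x. B x \<in> carrier_mat n n"
  shows "conn_bracket n (\<lambda>y. b_mat n + u y) B x \<in> carrier_mat n n"
  using assms by (auto simp: conn_bracket_def mat_deriv_def)

text \<open>Used for the lower right corner, which the column recursion does not control.\<close>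

lemma conn_bracket_trace:
  assumes "\<And>x. B x \<in> carrier_mat n n"
  shows "mat_trace n (conn_bracket n (\<lambda>y. b_mat n + u y) B x) = (\<Sum>r<n. deriv (\<lambda>y. B y $$ (r, r)) x)"
proof -
  let ?A = "b_mat n + u x"
  have A: "?A \<in> carrier_mat n n"
    by auto
  have "mat_trace n (conn_bracket n (\<lambda>y. b_mat n + u y) B x)
      = (\<Sum>r<n. deriv (\<lambda>y. B y $$ (r, r)) x) + (mat_trace n (?A * B x) - mat_trace n (B x * ?A))"
    using assms[of x] A u_carrier[of x]
    by (simp add: mat_trace_def conn_bracket_def commutator_def mat_deriv_def sum.distrib
        sum_subtractf del: index_mult_mat(1))
  then show ?thesis
    using mat_trace_mult_commute[OF A assms] by simp
qed

lemma band_mult_conn: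
  assumes W: "W \<in> carrier_mat n n" "band_le n W d" and c: "c mod int n \<noteq> int n - 1"
  shows "band n (W * conn x) r c = band n W r (c + 1)"
proof -
  let ?S = "insert (c + 1) {r - d..c + 1}"
  have "c \<noteq> last_col s" for s
    using c eq_last_col_iff by blast
  then have conn: "band n (conn x) s c = (if s = c + 1 then 1 else 0)" for s
    by (auto simp: band_conn)
  have "band n (W * conn x) r c = (\<Sum>s\<in>?S. band n W r s * band n (conn x) s c)"
    by (rule band_mult_superset[OF n0 W(1) conn_carrier W(2) band_le_conn]) auto
  also have "\<dots> = (\<Sum>s\<in>?S. if s = c + 1 then band n W r s else 0)"
    by (intro sum.cong) (auto simp: conn)
  also have "\<dots> = band n W r (c + 1)"
    by (subst sum.delta) auto
  finally show ?thesis .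
qed

definition P :: "nat \<Rightarrow> real \<Rightarrow> real mat" where
  "P j x = lam_coeff 0 (Ysol x ^\<^sub>m j)"

lemma Y_coeff_eq: "Y_coeff n j 0 u = P j"
  by (rule ext) (simp add: Y_coeff_def Y_series_eq P_def)

lemma Ysol_carrier [simp, intro]: "Ysol x \<in> carrier_mat n n"
  by (auto simp: Ysol_def)

lemma P_carrier [simp, intro]: "P j x \<in> carrier_mat n n"
  by (auto simp: P_def)

lemma P_index: "r < n \<Longrightarrow> c < n \<Longrightarrow> P j x $$ (r, c) = band n (Ysol x ^\<^sub>m j) (int r) (int c)"
  by (simp add: P_def lam_coeff_index[where n = n])

lemma smooth_P: "r < n \<Longrightarrow> c < n \<Longrightarrow> smooth (\<lambda>x. P j x $$ (r, c))"
  using Ysol_pow_smooth_band[of j] by (simp add: P_index smooth_band_def)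

lemma Ysol_pow_eq_band:
  "deriv (\<lambda>y. band n (Ysol y ^\<^sub>m j) r c) x + band n (conn x * Ysol x ^\<^sub>m j) r c
    - band n (Ysol x ^\<^sub>m j * conn x) r c = 0"
  using arg_cong[OF Ysol_pow_eq[of j x], of "\<lambda>M. band n M r c"] n0
  by (simp add: commutator_def band_add band_minus band_zero
      band_band_deriv[OF n0 Ysol_pow_smooth_band])

text \<open>Row 0 is excluded: there \<lambda> e_{1n} on the left brings in the coefficient of
  \<lambda>^(-1). In the other rows the coefficient of \<lambda>^0 satisfies a closed recursion, the
  same one as \<open>zcol\<close>.\<close>

lemma P_step:
  assumes rc: "0 < r" "r < n" "c < n - 1"
  shows "P j x $$ (r, Suc c) = deriv (\<lambda>y. P j y $$ (r, c)) x + P j x $$ (r - 1, c)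
    + u x $$ (r, n - 1) * P j x $$ (n - 1, c)"
proof -
  have W: "Ysol x ^\<^sub>m j \<in> carrier_mat n n" "band_le n (Ysol x ^\<^sub>m j) (int j)"
    using Ysol_pow_smooth_band[of j] by (auto simp: smooth_band_def)
  have c: "int c mod int n \<noteq> int n - 1"
    using rc by simp
  have "last_col (int r) = int (n - 1)"
    using rc by (simp add: last_col_def)
  moreover have "U (int r) x = u x $$ (r, n - 1)"
    using rc by (simp add: U_def)
  moreover have "int r - 1 = int (r - 1)" "int c + 1 = int (Suc c)"
    using rc by auto
  ultimately have "deriv (\<lambda>y. band n (Ysol y ^\<^sub>m j) (int r) (int c)) x
      + (band n (Ysol x ^\<^sub>m j) (int (r - 1)) (int c)
        + u x $$ (r, n - 1) * band n (Ysol x ^\<^sub>m j) (int (n - 1)) (int c))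
      - band n (Ysol x ^\<^sub>m j) (int r) (int (Suc c)) = 0"
    using Ysol_pow_eq_band[of j "int r" "int c" x]
    by (simp only: band_conn_mult[OF W] band_mult_conn[OF W c])
  moreover have "r - 1 < n" "n - 1 < n" "c < n" "Suc c < n"
    using rc by auto
  ultimately show ?thesis
    using rc by (simp add: P_index del: of_nat_Suc of_nat_diff)
qed

text \<open>The trace is taken before the coefficient of \<lambda>^0 is extracted, since
  \<open>P\<close> alone does not satisfy the commutator equation.\<close>

lemma P_trace_deriv: "(\<Sum>r<n. deriv (\<lambda>y. P j y $$ (r, r)) x) = 0"
proof -
  let ?W = "Ysol x ^\<^sub>m j"
  have "(\<Sum>r<n. band n M (int r) (int r)) = fls_nth (mat_trace n M) 0" for M
    by (simp add: mat_trace_def fls_nth_sum fls_nth_eq_band)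
  moreover have "mat_trace n (conn x * ?W) = mat_trace n (?W * conn x)"
    by (rule mat_trace_mult_commute) auto
  ultimately have "(\<Sum>r<n. band n (conn x * ?W) (int r) (int r)) = (\<Sum>r<n. band n (?W * conn x) (int r) (int r))"
    by simp
  moreover have "(\<Sum>r<n. deriv (\<lambda>y. band n (Ysol y ^\<^sub>m j) (int r) (int r)) x
      + band n (conn x * ?W) (int r) (int r) - band n (?W * conn x) (int r) (int r)) = 0"
    using Ysol_pow_eq_band by (intro sum.neutral) auto
  ultimately have "(\<Sum>r<n. deriv (\<lambda>y. band n (Ysol y ^\<^sub>m j) (int r) (int r)) x) = 0"
    by (simp add: sum.distrib sum_subtractf)
  then show ?thesis
    by (simp add: P_index)
qed

text \<open>
  The condition on the first \<open>n - 1\<close> columns of the bracket determines \<open>Z\<close> column by column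
  from its first column, which is that of \<open>Y\<^sub>j\<^sub>,\<^sub>0\<close>.
\<close>

fun zcol :: "nat \<Rightarrow> nat \<Rightarrow> nat \<Rightarrow> real \<Rightarrow> real" where
  "zcol j 0 r = (\<lambda>x. P j x $$ (r, 0))"
| "zcol j (Suc c) r = (\<lambda>x. deriv (zcol j c r) x + (if r = 0 then 0 else zcol j c (r - 1) x)
     + u x $$ (r, n - 1) * zcol j c (n - 1) x)"

definition zmat :: "nat \<Rightarrow> real \<Rightarrow> real mat" where
  "zmat j x = Matrix.mat n n (\<lambda>(r, c). zcol j c r x)"

lemma zmat_carrier [simp, intro]: "zmat j x \<in> carrier_mat n n"
  by (simp add: zmat_def)

lemma smooth_zcol: "r < n \<Longrightarrow> smooth (zcol j c r)"
proof (induction c arbitrary: r)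
  case 0
  then show ?case by (simp add: smooth_P)
next
  case (Suc c)
  then show ?case
    using u_smooth unfolding zcol.simps
    by (intro smooth_add smooth_mult smooth_if smooth_deriv) (auto simp: smooth_mat_def)
qed

text \<open>For an entry on or below the diagonal and outside column 0, the recursion refers only to
  entries of the same kind and never to row 0 as its own row, so \<open>P_step\<close> applies
  throughout. Hence \<zeta> is strictly upper triangular.\<close>

lemma zcol_lower: "c \<le> r \<Longrightarrow> r < n \<Longrightarrow> zcol j c r x = P j x $$ (r, c)"
proof (induction c arbitrary: r x)
  case (Suc c)
  have "zcol j c r = (\<lambda>x. P j x $$ (r, c))"
    using Suc by (intro ext) simp
  then show ?case
    using Suc P_step[of r c j x] by simp
qed simp

text \<open>All columns but the last vanish by construction, so the remaining corner equals the
  trace. This depends only on the diagonal, where \<open>zmat\<close> agrees with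
  \<open>P\<close>.\<close>

lemma zmat_bracket: "conn_bracket n (\<lambda>y. b_mat n + u y) (zmat j) x \<in> V_space n"
proof (rule in_V_spaceI)
  let ?M = "conn_bracket n (\<lambda>y. b_mat n + u y) (zmat j) x"
  show 0: "?M $$ (r, c) = 0" if "r < n" "c < n - 1" for r c
    using that by (simp add: conn_bracket_index) (simp add: zmat_def)
  have "?M $$ (n - 1, n - 1) = mat_trace n ?M"
  proof -
    have "?M $$ (r, r) = 0" if "r \<in> {..<n} - {n - 1}" for r
      using that by (intro 0) auto
    then show ?thesis
      unfolding mat_trace_def using n0 by (subst sum.remove[of _ "n - 1"]) auto
  qed
  also have "\<dots> = (\<Sum>r<n. deriv (\<lambda>y. zmat j y $$ (r, r)) x)"
    by (rule conn_bracket_trace) auto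
  also have "\<dots> = (\<Sum>r<n. deriv (\<lambda>y. P j y $$ (r, r)) x)"
    by (intro sum.cong refl) (simp add: zmat_def zcol_lower)
  finally show "?M $$ (n - 1, n - 1) = 0"
    by (simp add: P_trace_deriv)
qed auto

lemma is_zeta_zmat: "is_zeta n j u (\<lambda>x. P j x - zmat j x)"
proof -
  have "P j x - (P j x - zmat j x) = zmat j x" for x
    using P_carrier[of j x] zmat_carrier[of j x] by (auto intro!: eq_matI)
  moreover have "smooth_mat n (\<lambda>x. P j x - zmat j x)"
    using smooth_P smooth_zcol by (auto simp: smooth_mat_def zmat_def intro!: smooth_diff)
  ultimately show ?thesis
    using zmat_bracket by (auto simp: is_zeta_def Y_coeff_eq) (simp add: zmat_def zcol_lower)
qed

text \<open>Strict upper triangularity fixes column 0 of the difference \<open>B\<close>, and the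
  bracket condition then fixes each following column.\<close>

lemma is_zeta_unique:
  assumes "is_zeta n j u \<zeta>"
  shows "\<zeta> = (\<lambda>x. P j x - zmat j x)"
proof -
  define B where "B = (\<lambda>x. P j x - \<zeta> x)"
  have car: "\<zeta> x \<in> carrier_mat n n" "B x \<in> carrier_mat n n" for x
    using assms by (auto simp: is_zeta_def smooth_mat_def B_def)
  have V: "conn_bracket n (\<lambda>y. b_mat n + u y) B x \<in> V_space n" for x
    using assms by (simp add: is_zeta_def B_def Y_coeff_eq)
  have B: "B x $$ (r, c) = zcol j c r x" if "c < n" "r < n" for r c x
    using that
  proof (induction c arbitrary: r x)
    case 0
    then show ?case
      using assms car[of x] by (simp add: B_def is_zeta_def)
  next
    case (Suc c)
    have "conn_bracket n (\<lambda>y. b_mat n + u y) B x $$ (r, c) = 0"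
      using V[of x] Suc.prems by (auto simp: V_space_def u_mat_def)
    moreover have "(\<lambda>y. B y $$ (r, c)) = zcol j c r"
      using Suc by (intro ext) simp
    ultimately show ?case
      using Suc by (auto simp: conn_bracket_index[OF car(2)])
  qed
  have "\<zeta> x $$ (r, c) = (P j x - zmat j x) $$ (r, c)" if "r < n" "c < n" for x r c
    using B[OF that(2,1), of x] that car(1)[of x] P_carrier[of j x] by (simp add: B_def zmat_def)
  then show ?thesis
    using carrier_matD[OF car(1)] by (intro ext eq_matI) (auto simp: zmat_def)
qed

lemma Z0_eq: "Z0 n j u = zmat j"
proof -
  have "zeta n j u = (\<lambda>x. P j x - zmat j x)"
    unfolding zeta_def
    by (rule the_equality[where P = "is_zeta n j u"]) (auto intro: is_zeta_zmat is_zeta_unique)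
  then show ?thesis
    using P_carrier zmat_carrier
    by (intro ext) (auto simp: Z0_def Y_coeff_eq intro!: eq_matI)
qed

lemma Z0_shift:
  assumes "\<And>x. u (x + a) = u x"
  shows "Z0 n j u (x + a) = Z0 n j u x"
proof -
  have "Ysol (x + a) = Ysol x" for x
    using is_Y_unique[OF is_Y_shift[OF is_Y_Ysol assms] is_Y_Ysol] by (rule fun_cong)
  then have P: "P j (x + a) = P j x" for x
    by (simp add: P_def)
  have "zcol j c r (x + a) = zcol j c r x" for c r x
  proof (induction c arbitrary: r x)
    case (Suc c)
    then show ?case
      using deriv_shift[of "zcol j c r" a x] by (simp add: assms)
  qed (simp add: P)
  then show ?thesis
    by (simp add: Z0_eq zmat_def)
qed

lemma Z0_carrier: "Z0 n j u x \<in> carrier_mat n n"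
  by (simp add: Z0_eq)

end

section \<open>Linear equations and moving frames\<close>

lemma mat_deriv_carrier [simp, intro]: "mat_deriv n F x \<in> carrier_mat n n"
  by (simp add: mat_deriv_def)

lemma smooth_matD:
  assumes "smooth_mat n F"
  shows "F x \<in> carrier_mat n n" and "r < n \<Longrightarrow> c < n \<Longrightarrow> smooth (\<lambda>x. F x $$ (r, c))"
  using assms by (auto simp: smooth_mat_def)

lemma smooth_mat_mult:
  assumes "smooth_mat n F" "smooth_mat n G"
  shows "smooth_mat n (\<lambda>x. F x * G x)"
  unfolding smooth_mat_def
proof (intro conjI allI impI)
  fix r c assume rc: "r < n" "c < n"
  have "(\<lambda>x. (F x * G x) $$ (r, c)) = (\<lambda>x. \<Sum>s<n. F x $$ (r, s) * G x $$ (s, c))"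
    using rc by (intro ext mult_mat_sum smooth_matD assms)
  then show "smooth (\<lambda>x. (F x * G x) $$ (r, c))"
    using rc assms by (auto simp: smooth_mat_def simp del: index_mult_mat(1) intro!: smooth_sum smooth_mult)
qed (use assms in \<open>auto simp: smooth_mat_def\<close>)

lemma mat_deriv_mult:
  fixes F G :: "real \<Rightarrow> real mat"
  assumes F: "smooth_mat n F" and G: "smooth_mat n G"
  shows "mat_deriv n (\<lambda>x. F x * G x) x = mat_deriv n F x * G x + F x * mat_deriv n G x"
proof (rule eq_matI)
  note car = smooth_matD(1)[OF F] smooth_matD(1)[OF G]
  have dims: "dim_row (F x) = n" "dim_col (F x) = n" "dim_row (G x) = n" "dim_col (G x) = n"
    using car[of x] by auto
  fix r c assume "r < dim_row (mat_deriv n F x * G x + F x * mat_deriv n G x)"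
    and "c < dim_col (mat_deriv n F x * G x + F x * mat_deriv n G x)"
  then have rc: "r < n" "c < n"
    using dims by (auto simp: mat_deriv_def)
  have "mat_deriv n (\<lambda>x. F x * G x) x $$ (r, c)
      = deriv (\<lambda>x. \<Sum>s<n. F x $$ (r, s) * G x $$ (s, c)) x"
    using rc by (simp add: mat_deriv_def mult_mat_sum[OF car] del: index_mult_mat(1))
  also have "\<dots> = (\<Sum>s<n. deriv (\<lambda>y. F y $$ (r, s)) x * G x $$ (s, c)
      + deriv (\<lambda>y. G y $$ (s, c)) x * F x $$ (r, s))"
    using rc by (intro DERIV_imp_deriv DERIV_sum DERIV_mult smooth_DERIV smooth_matD(2)[OF F]
        smooth_matD(2)[OF G]) auto
  also have "\<dots> = (mat_deriv n F x * G x) $$ (r, c) + (F x * mat_deriv n G x) $$ (r, c)"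
    using rc by (simp add: mult_mat_sum[OF mat_deriv_carrier car(2)]
        mult_mat_sum[OF car(1) mat_deriv_carrier] sum.distrib del: index_mult_mat(1))
      (simp add: mat_deriv_def mult.commute)
  finally show "mat_deriv n (\<lambda>x. F x * G x) x $$ (r, c)
      = (mat_deriv n F x * G x + F x * mat_deriv n G x) $$ (r, c)"
    using rc dims by (simp add: mat_deriv_def del: index_mult_mat(1))
qed (use smooth_matD(1)[OF F, of x] smooth_matD(1)[OF G, of x] in \<open>auto simp: mat_deriv_def\<close>)

lemma smooth_prod:
  fixes f :: "'i \<Rightarrow> 'a::real_normed_vector \<Rightarrow> real"
  shows "(\<And>i. i \<in> I \<Longrightarrow> smooth (f i)) \<Longrightarrow> smooth (\<lambda>x. \<Prod>i\<in>I. f i x)"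
  by (induction I rule: infinite_finite_induct) auto

lemma smooth_det:
  fixes M :: "'a::real_normed_vector \<Rightarrow> real mat"
  assumes "smooth_mat n M"
  shows "smooth (\<lambda>x. det (M x))"
proof -
  have "(\<lambda>x. det (M x)) = (\<lambda>x. \<Sum>p\<in>{p. p permutes {0..<n}}. signof p * (\<Prod>i=0..<n. M x $$ (i, p i)))"
    using smooth_matD(1)[OF assms] by (intro ext det_def')
  moreover have "smooth (\<lambda>x. \<Sum>p\<in>{p. p permutes {0..<n}}. signof p * (\<Prod>i=0..<n. M x $$ (i, p i)))"
    using smooth_matD(2)[OF assms]
    by (intro smooth_sum smooth_mult smooth_prod smooth_const) (auto simp: permutes_in_image)
  ultimately show ?thesis
    by simp
qed

text \<open>For determinant 1 the adjugate is the inverse, and its entries are polynomials in those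
  of the matrix, so no division has to be differentiated.\<close>

lemma smooth_mat_adj_mat:
  assumes G: "smooth_mat n G"
  shows "smooth_mat n (\<lambda>x. adj_mat (G x))"
  unfolding smooth_mat_def
proof (intro conjI allI impI)
  note car = smooth_matD(1)[OF G]
  show "adj_mat (G x) \<in> carrier_mat n n" for x
    using adj_mat(1)[OF car] .
  fix r c assume rc: "r < n" "c < n"
  have dims: "dim_row (G x) = n" "dim_col (G x) = n" for x
    using car[of x] by auto
  have "smooth_mat (n - 1) (\<lambda>x. mat_delete (G x) c r)"
    using rc dims smooth_matD(2)[OF G] by (auto simp: smooth_mat_def mat_delete_def)
  from smooth_det[OF this] have "smooth (\<lambda>x. (- 1) ^ (c + r) * det (mat_delete (G x) c r))"
    by (intro smooth_mult smooth_const)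
  then show "smooth (\<lambda>x. adj_mat (G x) $$ (r, c))"
    using rc dims by (simp add: adj_mat_def cofactor_def)
qed

text \<open>The quotient C = G H^(-1) is constant. Differentiating C H = G gives C' H + G B = G B,
  which avoids a formula for the derivative of the inverse.\<close>

lemma linear_ode_unique:
  fixes G H B :: "real \<Rightarrow> real mat"
  assumes G: "smooth_mat n G" "\<And>x. mat_deriv n G x = G x * B x"
    and H: "smooth_mat n H" "\<And>x. mat_deriv n H x = H x * B x"
    and B: "\<And>x. B x \<in> carrier_mat n n"
    and det: "\<And>x. det (H x) = 1" and init: "G a = H a"
  shows "G x = H x"
proof -
  note assoc = assoc_mult_mat[where ?n\<^sub>1.0 = n and ?n\<^sub>2.0 = n and ?n\<^sub>3.0 = n and ?n\<^sub>4.0 = n]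
  define K where "K = (\<lambda>x. adj_mat (H x))"
  have K: "smooth_mat n K"
    unfolding K_def by (rule smooth_mat_adj_mat[OF H(1)])
  note car [simp] = smooth_matD(1)[OF G(1)] smooth_matD(1)[OF H(1)] smooth_matD(1)[OF K] B
  have inv: "H x * K x = 1\<^sub>m n" "K x * H x = 1\<^sub>m n" for x
    using adj_mat(2,3)[OF smooth_matD(1)[OF H(1), of x]] by (auto simp: K_def det intro!: eq_matI)
  define C where "C = (\<lambda>x. G x * K x)"
  have C: "smooth_mat n C"
    unfolding C_def by (rule smooth_mat_mult[OF G(1) K])
  note [simp] = smooth_matD(1)[OF C]
  have CH: "C x * H x = G x" for x
    by (simp add: C_def assoc inv right_mult_one_mat[where nr = n])
  have C': "mat_deriv n C x = 0\<^sub>m n n" for x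
  proof -
    have "G x * B x = mat_deriv n C x * H x + C x * (H x * B x)"
      using mat_deriv_mult[OF C H(1), of x] unfolding CH G(2) H(2) .
    also have "C x * (H x * B x) = G x * B x"
      by (simp add: assoc[symmetric] CH)
    finally have "mat_deriv n C x * H x + G x * B x = G x * B x" ..
    then have "mat_deriv n C x * H x = G x * B x - G x * B x"
      by (intro eq_minus_of_add_eq[where n = n]) auto
    also have "\<dots> = 0\<^sub>m n n"
      by (rule minus_r_inv_mat) simp
    finally have "mat_deriv n C x * H x * K x = 0\<^sub>m n n * K x"
      by simp
    then show ?thesis
      by (simp add: assoc inv right_mult_one_mat[where nr = n] left_mult_zero_mat[where n = n])
  qed
  have "C x $$ (r, c) = C a $$ (r, c)" if "r < n" "c < n" for r c
  proof (rule DERIV_isconst_all[of "\<lambda>y. C y $$ (r, c)" x a], rule allI)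
    fix y
    have "mat_deriv n C y $$ (r, c) = 0"
      using that by (simp add: C')
    then show "DERIV (\<lambda>y. C y $$ (r, c)) y :> 0"
      using smooth_DERIV[OF smooth_matD(2)[OF C that], of y] that by (simp add: mat_deriv_def)
  qed
  then have "C x = C a"
    using carrier_matD[OF smooth_matD(1)[OF C]] by (intro eq_matI) auto
  also have "C a = 1\<^sub>m n"
    by (simp add: C_def init inv)
  finally show ?thesis
    using CH[of x] left_mult_one_mat[OF smooth_matD(1)[OF H(1)], of x] by simp
qed

lemma smooth_mat_slice:
  assumes "smooth_mat n (\<lambda>(x, t). F x t)"
  shows "smooth_mat n (\<lambda>x. F x t)" "smooth_mat n (F x)"
proof -
  have F: "smooth (\<lambda>(x, t). F x t $$ (r, c))" if "r < n" "c < n" for r c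
    using assms that by (simp add: smooth_mat_def case_prod_unfold)
  have "F x t \<in> carrier_mat n n" for x t
    using smooth_matD(1)[OF assms, of "(x, t)"] by simp
  then show "smooth_mat n (\<lambda>x. F x t)" "smooth_mat n (F x)"
    using smooth_slice[OF F] smooth_slice_snd[OF F] by (auto simp: smooth_mat_def)
qed

section \<open>Moving frames and central affine curvatures\<close>

lemma frame_index:
  "r < n \<Longrightarrow> k < n \<Longrightarrow> frame n \<gamma> x $$ (r, k) = vec_index ((vec_deriv n ^^ k) \<gamma> x) r"
  by (simp add: frame_def mat_of_cols_index)

lemma frame_carrier [simp, intro]: "frame n \<gamma> x \<in> carrier_mat n n"
  by (auto simp: frame_def mat_of_cols_def)

lemma u_mat_carrier [simp, intro]: "u_mat n w \<in> carrier_mat n n"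
  by (simp add: u_mat_def)

text \<open>Right multiplication by b shifts columns to the left, and \<open>u\<close> fills the
  last column with the combination that occurs in the curvature relation.\<close>

lemma mult_b_u_index:
  assumes G: "G \<in> carrier_mat n n" and rk: "r < n" "k < n"
  shows "(G * (b_mat n + u_mat n w)) $$ (r, k) =
    (if k < n - 1 then G $$ (r, Suc k) else \<Sum>i\<in>{1..n - 1}. w i * G $$ (r, i - 1))"
proof -
  have "(G * (b_mat n + u_mat n w)) $$ (r, k) = (\<Sum>s<n. G $$ (r, s) * (b_mat n + u_mat n w) $$ (s, k))"
    using G rk by (intro mult_mat_sum) auto
  also have "\<dots> = (\<Sum>s<n. G $$ (r, s) *
      ((if s = Suc k then 1 else 0) + (if s < n - 1 \<and> k = n - 1 then w (Suc s) else 0)))"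
    using rk by (intro sum.cong) (auto simp: b_mat_def u_mat_def)
  also have "\<dots> = (if k < n - 1 then G $$ (r, Suc k) else \<Sum>i\<in>{1..n - 1}. w i * G $$ (r, i - 1))"
  proof (cases "k < n - 1")
    case True
    then have "(\<Sum>s<n. G $$ (r, s) *
      ((if s = Suc k then 1 else 0) + (if s < n - 1 \<and> k = n - 1 then w (Suc s) else 0)))
      = (\<Sum>s<n. if s = Suc k then G $$ (r, s) else 0)"
      by (intro sum.cong) auto
    also have "\<dots> = G $$ (r, Suc k)"
      using True by (subst sum.delta) auto
    finally show ?thesis using True by simp
  next
    case False
    then have k: "k = n - 1" using rk by simp
    have "(\<Sum>s<n. G $$ (r, s) *
      ((if s = Suc k then 1 else 0) + (if s < n - 1 \<and> k = n - 1 then w (Suc s) else 0)))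
      = (\<Sum>s<n - 1. w (Suc s) * G $$ (r, s))"
      using rk k by (intro sum.mono_neutral_cong_right) auto
    also have "\<dots> = (\<Sum>i\<in>{1..n - 1}. w i * G $$ (r, i - 1))"
      by (rule sum.reindex_bij_witness[where i = "\<lambda>i. i - 1" and j = Suc]) auto
    finally show ?thesis using False by simp
  qed
  finally show ?thesis .
qed

lemma vec_deriv_pow_carrier:
  assumes "\<And>x. \<gamma> x \<in> carrier_vec n"
  shows "(vec_deriv n ^^ k) \<gamma> x \<in> carrier_vec n"
  using assms by (cases k) (auto simp: vec_deriv_def)

lemma curvature_index:
  assumes \<gamma>: "\<And>x. \<gamma> x \<in> carrier_vec n" and r: "r < n"
  shows "vec_index (finsum_vec TYPE(real) n (\<lambda>i. w i \<cdot>\<^sub>v (vec_deriv n ^^ (i - 1)) \<gamma> x) {1..n - 1}) r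
    = (\<Sum>i\<in>{1..n - 1}. w i * frame n \<gamma> x $$ (r, i - 1))"
proof -
  have car: "(vec_deriv n ^^ k) \<gamma> x \<in> carrier_vec n" for k
    by (rule vec_deriv_pow_carrier[OF \<gamma>])
  have "vec_index (finsum_vec TYPE(real) n (\<lambda>i. w i \<cdot>\<^sub>v (vec_deriv n ^^ (i - 1)) \<gamma> x) {1..n - 1}) r
      = (\<Sum>i\<in>{1..n - 1}. vec_index (w i \<cdot>\<^sub>v (vec_deriv n ^^ (i - 1)) \<gamma> x) r)"
    using r car by (intro index_finsum_vec) auto
  also have "\<dots> = (\<Sum>i\<in>{1..n - 1}. w i * frame n \<gamma> x $$ (r, i - 1))"
    using r carrier_vecD[OF car] by (intro sum.cong) (auto simp: frame_index)
  finally show ?thesis .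
qed

lemma vec_deriv_Suc_index:
  "r < n \<Longrightarrow> vec_index ((vec_deriv n ^^ Suc k) \<gamma> x) r = deriv (\<lambda>y. vec_index ((vec_deriv n ^^ k) \<gamma> y) r) x"
  by (simp add: vec_deriv_def)

lemma smooth_vec_deriv_pow:
  fixes \<gamma> :: "real \<Rightarrow> real Matrix.vec"
  assumes "smooth_vec n \<gamma>" "r < n"
  shows "smooth (\<lambda>x. vec_index ((vec_deriv n ^^ k) \<gamma> x) r)"
proof (induction k)
  case (Suc k)
  then show ?case
    unfolding vec_deriv_Suc_index[OF assms(2)] by (rule smooth_deriv)
qed (use assms in \<open>simp add: smooth_vec_def\<close>)

lemma smooth_mat_frame:
  "smooth_vec n \<gamma> \<Longrightarrow> smooth_mat n (frame n \<gamma>)"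
  by (auto simp: smooth_mat_def frame_index smooth_vec_deriv_pow)

text \<open>Only the last column needs the curvatures: its derivative is of order \<open>n\<close>
  and is no longer a column of the frame.\<close>

lemma frame_equation:
  assumes \<gamma>: "smooth_vec n \<gamma>" and curv: "central_affine_curvatures n \<gamma> w"
  shows "mat_deriv n (frame n \<gamma>) x = frame n \<gamma> x * (b_mat n + u_mat n (\<lambda>i. w i x))"
proof (rule eq_matI)
  fix r k assume "r < dim_row (frame n \<gamma> x * (b_mat n + u_mat n (\<lambda>i. w i x)))"
    "k < dim_col (frame n \<gamma> x * (b_mat n + u_mat n (\<lambda>i. w i x)))"
  then have rk: "r < n" "k < n"
    by (auto simp: u_mat_def frame_def mat_of_cols_def)
  have car: "\<gamma> x \<in> carrier_vec n" for x
    using \<gamma> by (simp add: smooth_vec_def)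
  have "mat_deriv n (frame n \<gamma>) x $$ (r, k) = vec_index ((vec_deriv n ^^ Suc k) \<gamma> x) r"
    unfolding vec_deriv_Suc_index[OF rk(1)] using rk by (simp add: mat_deriv_def frame_index)
  also have "\<dots> = (frame n \<gamma> x * (b_mat n + u_mat n (\<lambda>i. w i x))) $$ (r, k)"
  proof (cases "k < n - 1")
    case True
    then show ?thesis
      using rk frame_index[of r n "Suc k" \<gamma> x] by (simp add: mult_b_u_index del: index_mult_mat(1) funpow.simps)
  next
    case False
    then have "Suc k = n" using rk by simp
    then show ?thesis
      using False rk curv curvature_index[of \<gamma> n, OF car rk(1), where w = "\<lambda>i. w i x" and x = x]
      by (simp add: mult_b_u_index central_affine_curvatures_def del: index_mult_mat(1) funpow.simps)
  qed
  finally show "mat_deriv n (frame n \<gamma>) x $$ (r, k)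
      = (frame n \<gamma> x * (b_mat n + u_mat n (\<lambda>i. w i x))) $$ (r, k)" .
qed (auto simp: mat_deriv_def u_mat_def frame_def mat_of_cols_def)

lemma vec_deriv_shift: "vec_deriv n (\<lambda>y. f (y + a)) x = vec_deriv n f (x + a)"
  unfolding vec_deriv_def
  by (intro eq_vecI) (auto intro: deriv_shift[of "\<lambda>y. vec_index (f y) r" for r])

lemma frame_shift: "frame n (\<lambda>y. \<gamma> (y + a)) x = frame n \<gamma> (x + a)"
proof -
  have "(vec_deriv n ^^ k) (\<lambda>y. \<gamma> (y + a)) = (\<lambda>y. (vec_deriv n ^^ k) \<gamma> (y + a))" for k
    by (induction k) (simp_all add: vec_deriv_shift)
  then show ?thesis
    by (simp add: frame_def)
qed

lemma mult_unit_vec_index: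
  fixes A :: "'a::semiring_1 mat"
  shows "A \<in> carrier_mat n n \<Longrightarrow> r < n \<Longrightarrow> vec_index (A *\<^sub>v unit_vec n 0) r = A $$ (r, 0)"
  using scalar_prod_right_unit[of 0 n "Matrix.row A r"] by (cases n) auto

text \<open>The converse of \<open>frame_equation\<close>: the first \<open>n - 1\<close> columns of
  the equation force each column to be the derivative of the one before it, and the last column is
  then the curvature relation.\<close>

lemma first_column_of_frame:
  assumes n: "2 \<le> n" and G: "smooth_mat n G"
    and eq: "\<And>x. mat_deriv n G x = G x * (b_mat n + u_mat n (\<lambda>i. w i x))"
    and \<gamma>: "\<And>x. \<gamma> x = G x *\<^sub>v unit_vec n 0"
  shows "frame n \<gamma> = G" and "central_affine_curvatures n \<gamma> w"
proof -
  note car = smooth_matD(1)[OF G]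
  have \<gamma>car: "\<gamma> x \<in> carrier_vec n" for x
    using car[of x] by (auto simp: \<gamma>)
  have step: "deriv (\<lambda>y. G y $$ (r, k)) x = (if k < n - 1 then G x $$ (r, Suc k)
      else \<Sum>i\<in>{1..n - 1}. w i x * G x $$ (r, i - 1))" if "r < n" "k < n" for r k x
    using that arg_cong[OF eq, of "\<lambda>M. M $$ (r, k)" x]
    by (simp add: mult_b_u_index[OF car] mat_deriv_def del: index_mult_mat(1))
  have vd: "vec_index ((vec_deriv n ^^ k) \<gamma> x) r = G x $$ (r, k)" if "k < n" "r < n" for k r x
    using that
  proof (induction k arbitrary: x)
    case 0
    then show ?case by (simp add: \<gamma> mult_unit_vec_index[OF car] del: index_mult_mat_vec)
  next
    case (Suc k)
    then have "vec_index ((vec_deriv n ^^ Suc k) \<gamma> x) r = deriv (\<lambda>y. G y $$ (r, k)) x"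
      by (simp only: vec_deriv_Suc_index Suc_lessD)
    then show ?case
      using Suc.prems by (simp add: step del: funpow.simps)
  qed
  show fr: "frame n \<gamma> = G"
  proof (rule ext)
    fix x
    show "frame n \<gamma> x = G x"
      using carrier_matD[OF car[of x]] carrier_matD[OF frame_carrier[of n \<gamma> x]]
      by (intro eq_matI) (auto simp: frame_index vd)
  qed
  show "central_affine_curvatures n \<gamma> w"
    unfolding central_affine_curvatures_def
  proof (intro allI eq_vecI)
    fix x
    let ?R = "finsum_vec TYPE(real) n (\<lambda>i. w i x \<cdot>\<^sub>v (vec_deriv n ^^ (i - 1)) \<gamma> x) {1..n - 1}"
    have R: "?R \<in> carrier_vec n"
      using vec_deriv_pow_carrier[of \<gamma> n, OF \<gamma>car] by (intro finsum_vec_closed) auto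
    show "dim_vec ((vec_deriv n ^^ n) \<gamma> x) = dim_vec ?R"
      unfolding carrier_vecD[OF R] carrier_vecD[OF vec_deriv_pow_carrier[of \<gamma> n n x, OF \<gamma>car]] ..
    fix r assume "r < dim_vec ?R"
    then have r: "r < n"
      unfolding carrier_vecD[OF R] .
    have "vec_index ((vec_deriv n ^^ n) \<gamma> x) r = vec_index ((vec_deriv n ^^ Suc (n - 1)) \<gamma> x) r"
      using n by (simp del: funpow.simps)
    also have "\<dots> = deriv (\<lambda>y. G y $$ (r, n - 1)) x"
      unfolding vec_deriv_Suc_index[OF r] using r n by (simp add: vd)
    also have "\<dots> = vec_index ?R r"
      using r n step[of r "n - 1" x] curvature_index[of \<gamma> n, OF \<gamma>car r, where w = "\<lambda>i. w i x" and x = x] by (simp add: fr)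
    finally show "vec_index ((vec_deriv n ^^ n) \<gamma> x) r = vec_index ?R r" .
  qed
qed

section \<open>The curve reconstructed from a solution of the KdV flow\<close>

theorem theorem3p5:
  fixes n j :: nat
    and \<gamma>\<^sub>0 :: "real \<Rightarrow> real Matrix.vec"
    and u\<^sub>0 :: "nat \<Rightarrow> real \<Rightarrow> real"
    and u :: "nat \<Rightarrow> real \<Rightarrow> real \<Rightarrow> real"
    and g :: "real \<Rightarrow> real \<Rightarrow> real mat"
    and \<gamma> :: "real \<Rightarrow> real \<Rightarrow> real Matrix.vec"
  assumes "n \<ge> 2" and "j \<ge> 1" and "\<not> n dvd j"
    and "\<gamma>\<^sub>0 \<in> curves_S1 n"
    and "central_affine_curvatures n \<gamma>\<^sub>0 u\<^sub>0"
    and "kdv_solution n j u"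
    and "\<forall>i\<in>{1..n - 1}. \<forall>x t. u i (x + 2 * pi) t = u i x t"
    and "\<forall>i\<in>{1..n - 1}. \<forall>x. u i x 0 = u\<^sub>0 i x"
    and "smooth_mat n (\<lambda>(x, t). g x t)"
    and "\<forall>x t. g x t \<in> SL n"
    and "\<forall>x t. mat_deriv n (\<lambda>y. g y t) x = g x t * (b_mat n + u_mat n (\<lambda>i. u i x t))"
    and "\<forall>x t. mat_deriv n (g x) t = g x t * Z0 n j (\<lambda>y. u_mat n (\<lambda>i. u i y t)) x"
    and "g 0 0 = frame n \<gamma>\<^sub>0 0"
    and "\<forall>x t. \<gamma> x t = g x t *\<^sub>v unit_vec n 0"
  shows "curve_flow_solution n j \<gamma>
    \<and> (\<forall>x. \<gamma> x 0 = \<gamma>\<^sub>0 x)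
    \<and> (\<forall>x t. \<gamma> (x + 2 * pi) t = \<gamma> x t)
    \<and> (\<forall>t. central_affine_curvatures n (\<lambda>x. \<gamma> x t) (\<lambda>i x. u i x t))"
proof -
  define w where "w = (\<lambda>t y. u_mat n (\<lambda>i. u i y t))"
  have n0: "0 < n"
    using \<open>n \<ge> 2\<close> by simp
  \<comment> \<open>The functions \<open>u i\<close> are constrained only for \<open>i\<close> in
    \<open>{1..n - 1}\<close>, and \<open>u_mat\<close> reads no other index.\<close>
  have u_cong: "u_mat n v = u_mat n v'" if "\<forall>i\<in>{1..n - 1}. v i = v' i" for v v' :: "nat \<Rightarrow> real"
    using that by (intro eq_matI) (auto simp: u_mat_def)
  have pot: "kdv_potential n (w t)" for t
  proof (rule kdv_potential.intro)
    show "smooth_mat n (w t)"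
      unfolding smooth_mat_def
    proof (intro conjI allI impI)
      fix r c assume rc: "r < n" "c < n"
      have "smooth (\<lambda>y. u (r + 1) y t)" if "r < n - 1"
        by (rule smooth_slice) (use \<open>kdv_solution n j u\<close> that in \<open>simp add: kdv_solution_def\<close>)
      then have "smooth (\<lambda>y. if r < n - 1 \<and> c = n - 1 then u (r + 1) y t else 0)"
        by (intro smooth_if) auto
      then show "smooth (\<lambda>y. w t y $$ (r, c))"
        using rc by (simp add: w_def u_mat_def)
    qed (simp add: w_def)
  qed (use \<open>n \<ge> 2\<close> in \<open>auto simp: w_def V_space_def\<close>)
  have w_per: "w t (x + 2 * pi) = w t x" for t x
    using assms(7) by (auto simp: w_def intro: u_cong)
  have Z_per: "Z0 n j (w t) (x + 2 * pi) = Z0 n j (w t) x" for t x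
    by (rule kdv_potential.Z0_shift[OF pot w_per])
  have Z_car [simp]: "Z0 n j (w t) x \<in> carrier_mat n n" for t x
    by (rule kdv_potential.Z0_carrier[OF pot])
  have gt: "mat_deriv n (g x) t = g x t * Z0 n j (w t) x" for x t
    using assms(12) by (simp add: w_def)
  have gcar [simp]: "g x t \<in> carrier_mat n n" and gdet: "det (g x t) = 1" for x t
    using assms(10) by (auto simp: SL_def)
  note gs = smooth_mat_slice[OF assms(9)]
  have \<gamma>: "\<gamma> x t = g x t *\<^sub>v unit_vec n 0" for x t
    using assms(14) by simp
  have \<gamma>index: "vec_index (\<gamma> x t) r = g x t $$ (r, 0)" if "r < n" for x t r
    unfolding \<gamma> using that by (intro mult_unit_vec_index) simp_all
  have \<gamma>car: "\<gamma> x t \<in> carrier_vec n" for x t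
    unfolding \<gamma> by (rule mult_mat_vec_carrier[OF gcar unit_vec_carrier])
  have fr: "frame n (\<lambda>y. \<gamma> y t) = (\<lambda>y. g y t)"
    and curv: "central_affine_curvatures n (\<lambda>x. \<gamma> x t) (\<lambda>i x. u i x t)" for t
    by (rule first_column_of_frame[OF \<open>n \<ge> 2\<close> gs(1)[of t] assms(11)[rule_format] \<gamma>])+
  have \<gamma>0: "smooth_vec n \<gamma>\<^sub>0" "\<And>x. det (frame n \<gamma>\<^sub>0 x) = 1" "\<And>x. \<gamma>\<^sub>0 (x + 2 * pi) = \<gamma>\<^sub>0 x"
    using assms(4) by (auto simp: curves_S1_def curves_R_def)
  have \<gamma>0car: "\<gamma>\<^sub>0 x \<in> carrier_vec n" for x
    using \<gamma>0(1) by (simp add: smooth_vec_def)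
  have u0: "u_mat n (\<lambda>i. u i x 0) = u_mat n (\<lambda>i. u\<^sub>0 i x)" for x
    using assms(8) by (intro u_cong) simp
  have g0: "g x 0 = frame n \<gamma>\<^sub>0 x" for x
  proof (rule linear_ode_unique[where G = "\<lambda>x. g x 0" and B = "\<lambda>x. b_mat n + u_mat n (\<lambda>i. u\<^sub>0 i x)"])
    show "mat_deriv n (\<lambda>x. g x 0) x = g x 0 * (b_mat n + u_mat n (\<lambda>i. u\<^sub>0 i x))" for x
      using assms(11) u0 by simp
    show "mat_deriv n (frame n \<gamma>\<^sub>0) x = frame n \<gamma>\<^sub>0 x * (b_mat n + u_mat n (\<lambda>i. u\<^sub>0 i x))" for x
      by (rule frame_equation[OF \<gamma>0(1) assms(5)])
  qed (auto intro: gs(1) smooth_mat_frame[OF \<gamma>0(1)] \<gamma>0(2) assms(13))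
  have init: "\<gamma> x 0 = \<gamma>\<^sub>0 x" for x
  proof (rule eq_vecI)
    fix r assume "r < dim_vec (\<gamma>\<^sub>0 x)"
    then have "r < n" using \<gamma>0car[of x] by simp
    then show "vec_index (\<gamma> x 0) r = vec_index (\<gamma>\<^sub>0 x) r"
      using n0 by (simp add: \<gamma>index g0 frame_index)
  qed (use \<gamma>car[of x 0] \<gamma>0car[of x] in simp)
  \<comment> \<open>The evolution in \<open>t\<close> needs the whole frame to be periodic at time
    0; it is, because differentiation commutes with translation.\<close>
  have g0_per: "g (x + 2 * pi) 0 = g x 0" for x
  proof -
    have "frame n (\<lambda>y. \<gamma>\<^sub>0 (y + 2 * pi)) x = frame n \<gamma>\<^sub>0 (x + 2 * pi)"
      by (rule frame_shift)
    then show ?thesis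
      by (simp add: g0 \<gamma>0(3))
  qed
  have g_per: "g (x + 2 * pi) t = g x t" for x t
  proof (rule linear_ode_unique[where B = "\<lambda>t. Z0 n j (w t) x"])
    show "mat_deriv n (g (x + 2 * pi)) t = g (x + 2 * pi) t * Z0 n j (w t) x" for t
      unfolding gt Z_per ..
    show "mat_deriv n (g x) t = g x t * Z0 n j (w t) x" for t
      by (rule gt)
    show "g (x + 2 * pi) 0 = g x 0"
      by (rule g0_per)
  qed (simp_all add: gs(2) gdet)
  have "curve_flow_solution n j \<gamma>"
    unfolding curve_flow_solution_def
  proof (intro conjI allI exI[of _ u])
    have "smooth (\<lambda>(x, t). g x t $$ (r, 0))" if "r < n" for r
      using smooth_matD(2)[OF assms(9) that n0] by (simp add: case_prod_unfold)
    then show "smooth_vec n (\<lambda>(x, t). \<gamma> x t)"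
      using \<gamma>car by (auto simp: smooth_vec_def case_prod_unfold \<gamma>index)
    show "(\<lambda>x. \<gamma> x t) \<in> curves_R n" for t
      unfolding curves_R_def
    proof (intro CollectI conjI allI)
      show "smooth_vec n (\<lambda>x. \<gamma> x t)"
        using \<gamma>car smooth_matD(2)[OF gs(1) _ n0] by (auto simp: smooth_vec_def \<gamma>index)
      show "det (frame n (\<lambda>x. \<gamma> x t) x) = 1" for x
        by (simp add: fr gdet)
      \<comment> \<open>A zero first column would put the first unit vector into the kernel of a
        matrix of determinant 1.\<close>
      show "\<gamma> x t \<noteq> 0\<^sub>v n" for x
      proof
        assume "\<gamma> x t = 0\<^sub>v n"
        then have "g x t *\<^sub>v unit_vec n 0 = 0\<^sub>v n"
          by (simp add: \<gamma>)
        moreover have "unit_vec n 0 \<noteq> (0\<^sub>v n :: real Matrix.vec)"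
          using n0 by (metis index_unit_vec(1) index_zero_vec(1) zero_neq_one)
        ultimately have "det (g x t) = 0"
          using det_0_iff_vec_prod_zero_field[OF gcar[of x t]] by (metis unit_vec_carrier)
        then show False
          by (simp add: gdet)
      qed
    qed
    show "central_affine_curvatures n (\<lambda>x. \<gamma> x t) (\<lambda>i x. u i x t)" for t
      by (rule curv)
    show "vec_deriv n (\<gamma> x) t = frame n (\<lambda>y. \<gamma> y t) x * Z0 n j (\<lambda>y. u_mat n (\<lambda>i. u i y t)) x *\<^sub>v unit_vec n 0" for x t
    proof -
      have "vec_deriv n (\<gamma> x) t = mat_deriv n (g x) t *\<^sub>v unit_vec n 0"
      proof (rule eq_vecI)
        fix r assume "r < dim_vec (mat_deriv n (g x) t *\<^sub>v unit_vec n 0)"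
        then have "r < n"
          by (simp add: mat_deriv_def)
        then show "vec_index (vec_deriv n (\<gamma> x) t) r = vec_index (mat_deriv n (g x) t *\<^sub>v unit_vec n 0) r"
          unfolding mult_unit_vec_index[OF mat_deriv_carrier \<open>r < n\<close>]
          using n0 by (simp add: vec_deriv_def mat_deriv_def \<gamma>index)
      qed (simp add: vec_deriv_def mat_deriv_def)
      then show ?thesis
        by (simp add: fr gt w_def)
    qed
  qed
  moreover have "\<gamma> (x + 2 * pi) t = \<gamma> x t" for x t
    by (simp add: \<gamma> g_per)
  ultimately show ?thesis
    using init curv by blast
qed

end
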